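(* Let $R>0$. The horizontal degree $p$ and the vertical nodal number $q$ are locally constant on $\mathcal Z_{\rm reg}$. Consequently, they are constant on every connected component of $\mathcal Z_{\rm reg}$.
   Context: Fix $R>0$; $\mathbb T=\mathbb R/2\pi\mathbb Z$, $e_3=(0,0,1)$, $\mathbf x_0(\eta)=(R\cos\eta,R\sin\eta,0)$. Zero set. $\mathcal Z$ is the set of $(\lambda,\mathbf u)\in(0,+\infty)\times H^2(\mathbb T,\mathbb R^3)$ such that $\mathbf x=\mathbf x_0+\mathbf u$ is a ($2\pi$-periodic) solution of $\mathbf x\times\mathbf x''-\lambda e_3\times\mathbf x+\lambda\mathbf x'=0$ with $\|\mathbf x\|\equiv R$; it carries the topology induced by $(0,+\infty)\times H^2(\mathbb T,\mathbb R^3)$. Vertical polynomial. For $(\lambda,\mathbf u)\in\mathcal Z$, $\mathbf x=\mathbf x_0+\mathbf u$, the quantities $C=(\mathbf x\times\mathbf x')_3+\lambda x_3$ and $E=\frac\lambda2\|\mathbf x'\|^2+\lambda(x_2x_1'-x_1x_2')$ are constant in $\eta$, and $u=x_3$ satisfies $(u')^2=P(u)$ where $P(s)=a_3s^3-a_2s^2+a_1s+a_0$ with $a_0=\frac{2ER^2-\lambda C^2+2\lambda CR^2}{\lambda R^2}$, $a_1=\frac{2\lambda C-2\lambda R^2}{R^2}$, $a_2=\frac{2E+\lambda^3+2\lambda C}{\lambda R^2}$, $a_3=\frac{2\lambda}{R^2}$. Regular class. $\mathcal Z_{\rm reg}\subset\mathcal Z$ is the set of $(\lambda,\mathbf u)$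 such that, with $u=x_3$: (1) $-R<u(\eta)<R$ for all $\eta$; (2) $u$ is not constant; (3) with $e_1=\min_{\mathbb T}u$, $e_2=\max_{\mathbb T}u$, the polynomial $P$ has a third real root, the number $e_3$, with $-R<e_1<e_2<R$, $e_2<e_3$, and $P(s)=\frac{2\lambda}{R^2}(s-e_1)(s-e_2)(s-e_3)$. Discrete invariants. For $(\lambda,\mathbf u)\in\mathcal Z_{\rm reg}$, the horizontal degree is $p=\frac1{2\pi}\int_0^{2\pi}\frac{x_1x_2'-x_2x_1'}{x_1^2+x_2^2}\,d\eta\in\mathbb Z$, and the vertical nodal number $q\in\mathbb N$ is the number of full oscillations of $x_3$ on $[0,2\pi]$, i.e. the minimal period of $x_3$ is $2\pi/q$. *)

theory Defs
  imports "HOL-Analysis.Analysis"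
begin

text \<open>Maps on \<open>\<real>/2\<pi>\<int>\<close> are represented by \<open>2\<pi>\<close>-periodic functions on \<open>real\<close>, and an
  \<open>H\<^sup>2\<close> class by its unique continuous (indeed \<open>C\<^sup>1\<close>) representative.\<close>

definition has_period :: "(real \<Rightarrow> 'a) \<Rightarrow> real \<Rightarrow> bool" where
  "has_period f T \<longleftrightarrow> (\<forall>t. f (t + T) = f t)"

definition abs_cont_deriv :: "(real \<Rightarrow> real^3) \<Rightarrow> (real \<Rightarrow> real^3) \<Rightarrow> bool" where
  "abs_cont_deriv v w \<longleftrightarrow>
     (\<forall>s t. s \<le> t \<longrightarrow> w absolutely_integrable_on {s..t} \<and> v t - v s = integral {s..t} w)"

abbreviation vderiv :: "(real \<Rightarrow> real^3) \<Rightarrow> real \<Rightarrow> real^3" where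
  "vderiv u t \<equiv> vector_derivative u (at t)"

definition H2 :: "(real \<Rightarrow> real^3) set" where
  "H2 = {u. has_period u (2*pi) \<and> (\<forall>t. u differentiable (at t)) \<and>
            (\<exists>w. abs_cont_deriv (vderiv u) w \<and> (\<lambda>t. (norm (w t))\<^sup>2) integrable_on {0..2*pi})}"

text \<open>The second derivative of an \<open>H\<^sup>2\<close> function is only determined up to null sets
  (lemma \<open>abs_cont_deriv_unique\<close>), and it is only used in ways that do not depend on the
  choice made here.\<close>

definition vderiv2 :: "(real \<Rightarrow> real^3) \<Rightarrow> real \<Rightarrow> real^3" where
  "vderiv2 u = (SOME w. abs_cont_deriv (vderiv u) w)"

definition H2_norm :: "(real \<Rightarrow> real^3) \<Rightarrow> real" where
  "H2_norm u = sqrt (integral {0..2*pi}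
     (\<lambda>t. (norm (u t))\<^sup>2 + (norm (vderiv u t))\<^sup>2 + (norm (vderiv2 u t))\<^sup>2))"

text \<open>The locale \<^locale>\<open>Metric_space\<close> wants nonnegativity and symmetry for all arguments,
  hence the dummy value outside \<open>H2\<close>, which does not enter the topology.\<close>

definition H2_dist :: "(real \<Rightarrow> real^3) \<Rightarrow> (real \<Rightarrow> real^3) \<Rightarrow> real" where
  "H2_dist u v = (if u \<in> H2 \<and> v \<in> H2 then H2_norm (\<lambda>t. u t - v t) else 0)"

definition ambient_topology :: "(real \<times> (real \<Rightarrow> real^3)) topology" where
  "ambient_topology = prod_topology (top_of_set {0<..}) (Metric_space.mtopology H2 H2_dist)"

definition circle_curve :: "real \<Rightarrow> real \<Rightarrow> real^3" where
  "circle_curve R \<eta> = vector [R * cos \<eta>, R * sin \<eta>, 0]"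

definition curve :: "real \<Rightarrow> (real \<Rightarrow> real^3) \<Rightarrow> real \<Rightarrow> real^3" where
  "curve R u \<eta> = circle_curve R \<eta> + u \<eta>"

text \<open>For \<open>H\<^sup>2\<close> functions the differential equation is an equality of \<open>L\<^sup>2\<close> functions,
  that is, it holds almost everywhere. The parameter usually written as the letter lambda is
  called \<open>\<mu>\<close>, since the former is reserved for abstraction.\<close>

definition zero_set :: "real \<Rightarrow> (real \<times> (real \<Rightarrow> real^3)) set" where
  "zero_set R = {(\<mu>, u). \<mu> > 0 \<and> u \<in> H2 \<and>
     (\<forall>\<eta>. norm (curve R u \<eta>) = R) \<and>
     (AE \<eta> in lebesgue.
        cross3 (curve R u \<eta>) (vderiv2 (curve R u) \<eta>)
          - \<mu> *\<^sub>R cross3 (axis 3 1) (curve R u \<eta>) + \<mu> *\<^sub>R vderiv (curve R u) \<eta> = 0)}"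

definition C_fun :: "real \<Rightarrow> (real \<Rightarrow> real^3) \<Rightarrow> real \<Rightarrow> real" where
  "C_fun \<mu> x \<eta> = cross3 (x \<eta>) (vderiv x \<eta>) $ 3 + \<mu> * x \<eta> $ 3"

definition E_fun :: "real \<Rightarrow> (real \<Rightarrow> real^3) \<Rightarrow> real \<Rightarrow> real" where
  "E_fun \<mu> x \<eta> = \<mu> / 2 * (norm (vderiv x \<eta>))\<^sup>2
     + \<mu> * (x \<eta> $ 2 * vderiv x \<eta> $ 1 - x \<eta> $ 1 * vderiv x \<eta> $ 2)"

text \<open>On the zero set \<open>C_fun\<close> and \<open>E_fun\<close> do not depend on \<open>\<eta>\<close>, so the polynomial may be
  formed from their values at \<open>\<eta> = 0\<close>.\<close>

definition vertical_poly :: "real \<Rightarrow> real \<Rightarrow> (real \<Rightarrow> real^3) \<Rightarrow> real poly" where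
  "vertical_poly R \<mu> u =
    (let C = C_fun \<mu> (curve R u) 0; E = E_fun \<mu> (curve R u) 0;
         a0 = (2 * E * R\<^sup>2 - \<mu> * C\<^sup>2 + 2 * \<mu> * C * R\<^sup>2) / (\<mu> * R\<^sup>2);
         a1 = (2 * \<mu> * C - 2 * \<mu> * R\<^sup>2) / R\<^sup>2;
         a2 = (2 * E + \<mu>^3 + 2 * \<mu> * C) / (\<mu> * R\<^sup>2);
         a3 = 2 * \<mu> / R\<^sup>2
     in [:a0, a1, - a2, a3:])"

definition height :: "real \<Rightarrow> (real \<Rightarrow> real^3) \<Rightarrow> real \<Rightarrow> real" where
  "height R u \<eta> = curve R u \<eta> $ 3"

definition regular_set :: "real \<Rightarrow> (real \<times> (real \<Rightarrow> real^3)) set" where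
  "regular_set R = {(\<mu>, u) \<in> zero_set R.
     (\<forall>\<eta>. - R < height R u \<eta> \<and> height R u \<eta> < R) \<and>
     \<not> height R u constant_on UNIV \<and>
     (\<exists>e1 e2 e3.
        e1 \<in> range (height R u) \<and> (\<forall>\<eta>. e1 \<le> height R u \<eta>) \<and>
        e2 \<in> range (height R u) \<and> (\<forall>\<eta>. height R u \<eta> \<le> e2) \<and>
        - R < e1 \<and> e1 < e2 \<and> e2 < R \<and> e2 < e3 \<and>
        vertical_poly R \<mu> u = smult (2 * \<mu> / R\<^sup>2) ([:- e1, 1:] * [:- e2, 1:] * [:- e3, 1:]))}"

definition zero_topology :: "real \<Rightarrow> (real \<times> (real \<Rightarrow> real^3)) topology" where
  "zero_topology R = subtopology ambient_topology (zero_set R)"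

definition regular_topology :: "real \<Rightarrow> (real \<times> (real \<Rightarrow> real^3)) topology" where
  "regular_topology R = subtopology (zero_topology R) (regular_set R)"

text \<open>The horizontal degree is integer-valued on the regular set, as a winding number; the
  defining integral is kept as a real number.\<close>

definition horizontal_degree :: "real \<Rightarrow> real \<times> (real \<Rightarrow> real^3) \<Rightarrow> real" where
  "horizontal_degree R = (\<lambda>(\<mu>, u). let x = curve R u in
     1 / (2*pi) * integral {0..2*pi}
       (\<lambda>\<eta>. (x \<eta> $ 1 * vderiv x \<eta> $ 2 - x \<eta> $ 2 * vderiv x \<eta> $ 1) / ((x \<eta> $ 1)\<^sup>2 + (x \<eta> $ 2)\<^sup>2)))"

definition is_minimal_period :: "(real \<Rightarrow> real) \<Rightarrow> real \<Rightarrow> bool" where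
  "is_minimal_period f T \<longleftrightarrow>
     T > 0 \<and> has_period f T \<and> (\<forall>S. 0 < S \<and> has_period f S \<longrightarrow> T \<le> S)"

text \<open>A nonconstant continuous \<open>2\<pi>\<close>-periodic function has exactly one such \<open>q\<close>
  (lemma \<open>nodal_number_ex1\<close>), so \<open>THE\<close> is meaningful on the regular set.\<close>

definition vertical_nodal_number :: "real \<Rightarrow> real \<times> (real \<Rightarrow> real^3) \<Rightarrow> nat" where
  "vertical_nodal_number R = (\<lambda>(\<mu>, u).
     THE q. q > 0 \<and> is_minimal_period (height R u) (2*pi / real q))"

definition locally_constant_on :: "'a topology \<Rightarrow> ('a \<Rightarrow> 'b) \<Rightarrow> bool" where
  "locally_constant_on X f \<longleftrightarrow> (\<forall>z \<in> topspace X. \<exists>U. openin X U \<and> z \<in> U \<and> f constant_on U)"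

lemma abs_cont_deriv_unique:
  assumes "abs_cont_deriv v w" "abs_cont_deriv v w'"
  shows "negligible {t. w t \<noteq> w' t}"
proof -
  define f where "f = (\<lambda>t. w t - w' t)"
  have int: "w integrable_on {s..t}" "w' integrable_on {s..t}" for s t
    using assms unfolding abs_cont_deriv_def absolutely_integrable_on_def
    by (cases "s \<le> t"; force)+
  have int0: "integral {s..t} f = 0" for s t
  proof (cases "s \<le> t")
    case True
    then have "integral {s..t} w = integral {s..t} w'"
      using assms by (simp add: abs_cont_deriv_def)
    then show ?thesis
      unfolding f_def by (subst Henstock_Kurzweil_Integration.integral_diff[OF int]) simp
  qed auto
  have "f integrable_on cbox s t" for s t
    unfolding f_def cbox_interval by (intro integrable_diff int)
  then obtain N where N: "negligible N"
    and N': "\<And>x e. \<lbrakk>x \<notin> N; 0 < e\<rbrakk> \<Longrightarrow> \<exists>d>0. \<forall>h. 0 < h \<and> h < d \<longrightarrow>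
               norm (integral (cbox x (x + h *\<^sub>R One)) f /\<^sub>R h ^ DIM(real) - f x) < e"
    using integrable_ccontinuous_explicit[of f] by metis
  have "f x = 0" if x: "x \<notin> N" for x
  proof (rule ccontr)
    assume "f x \<noteq> 0"
    then obtain d where "d > 0" and d: "\<And>h. 0 < h \<and> h < d \<Longrightarrow>
        norm (integral (cbox x (x + h *\<^sub>R One)) f /\<^sub>R h ^ DIM(real) - f x) < norm (f x)"
      using N'[OF x, of "norm (f x)"] by auto
    show False
      using d[of "d/2"] \<open>d > 0\<close> by (simp add: int0)
  qed
  then show ?thesis
    by (intro negligible_subset[OF N]) (auto simp: f_def)
qed

lemma has_period_of_int:
  assumes "has_period f S"
  shows "f (t + of_int n * S) = f t"
proof -
  have nat: "f (t + real k * S) = f t" for k t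
  proof (induction k)
    case (Suc k)
    have "f (t + real (Suc k) * S) = f ((t + real k * S) + S)" by (simp add: algebra_simps)
    also have "\<dots> = f t" using Suc assms by (simp add: has_period_def)
    finally show ?case .
  qed simp
  show ?thesis
  proof (cases "n \<ge> 0")
    case True
    then show ?thesis using nat[of t "nat n"] by simp
  next
    case False
    then show ?thesis using nat[of "t + of_int n * S" "nat (- n)"] by simp
  qed
qed

lemma nodal_number_ex1:
  fixes f :: "real \<Rightarrow> real"
  assumes cont: "continuous_on UNIV f" and per: "has_period f (2*pi)"
    and nc: "\<not> f constant_on UNIV"
  shows "\<exists>!q::nat. q > 0 \<and> is_minimal_period f (2*pi / real q)"
proof -
  define A where "A = {S. 0 < S \<and> has_period f S}"
  have A2: "2*pi \<in> A" using per by (simp add: A_def)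
  obtain a b where ab: "f a \<noteq> f b" using nc by (metis constant_on_def)
  obtain \<epsilon> where "\<epsilon> > 0" and \<epsilon>: "\<And>y. dist y b < \<epsilon> \<Longrightarrow> dist (f y) (f b) < dist (f a) (f b)"
    using cont ab by (metis UNIV_I continuous_on_iff zero_less_dist_iff)
  have lb: "\<epsilon> \<le> S" if "S \<in> A" for S
  proof (rule ccontr)
    assume "\<not> \<epsilon> \<le> S"
    define n where "n = \<lfloor>(b - a) / S\<rfloor>"
    have S: "S > 0" "has_period f S" using that by (auto simp: A_def)
    have "of_int n * S \<le> b - a" "b - a < (of_int n + 1) * S"
      unfolding n_def using S by (simp_all add: pos_le_divide_eq[symmetric] pos_divide_less_eq[symmetric])
    then have "dist (a + of_int n * S) b < \<epsilon>"
      using \<open>\<not> \<epsilon> \<le> S\<close> by (simp add: dist_real_def algebra_simps)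
    then show False using \<epsilon> has_period_of_int[OF S(2)] by fastforce
  qed
  define T where "T = Inf A"
  have bdd: "bdd_below A" using lb by (meson bdd_belowI)
  have Tpos: "T > 0" using cInf_greatest[of A \<epsilon>] A2 lb \<open>\<epsilon> > 0\<close> unfolding T_def by force
  have Tle: "T \<le> S" if "S \<in> A" for S
    unfolding T_def using bdd that by (rule cInf_lower[rotated])
  have "T \<in> closure A" unfolding T_def using A2 bdd by (intro closure_contains_Inf) auto
  then obtain s where s: "\<And>n. s n \<in> A" "s \<longlonglongrightarrow> T" by (auto simp: closure_sequential)
  have "f (t + T) = f t" for t
  proof -
    have "isCont f (t + T)" using cont by (simp add: continuous_on_eq_continuous_at)
    then have "(\<lambda>n. f (t + s n)) \<longlonglongrightarrow> f (t + T)"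
      by (rule isCont_tendsto_compose) (intro tendsto_intros s)
    moreover have "f (t + s n) = f t" for n using s(1)[of n] by (simp add: A_def has_period_def)
    ultimately show ?thesis by (simp add: LIMSEQ_const_iff)
  qed
  then have perT: "has_period f T" by (simp add: has_period_def)
  have minT: "is_minimal_period f T"
    using Tpos perT Tle by (auto simp: is_minimal_period_def A_def)
  define n where "n = \<lfloor>2*pi / T\<rfloor>"
  have n: "of_int n * T \<le> 2*pi" "2*pi < (of_int n + 1) * T"
    unfolding n_def using Tpos by (simp_all add: pos_le_divide_eq[symmetric] pos_divide_less_eq[symmetric])
  have "has_period f (2*pi - of_int n * T)"
    unfolding has_period_def
  proof
    fix t
    have "f (t + (2*pi - of_int n * T)) = f ((t + 2*pi) + of_int (- n) * T)" by (simp add: algebra_simps)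
    also have "\<dots> = f (t + 2*pi)" by (rule has_period_of_int[OF perT])
    also have "\<dots> = f t" using per by (simp add: has_period_def)
    finally show "f (t + (2*pi - of_int n * T)) = f t" .
  qed
  then have eq: "2*pi = of_int n * T"
    using n Tle[of "2*pi - of_int n * T"] by (force simp: A_def algebra_simps)
  have "real_of_int n * T > 0" using eq pi_gt_zero by linarith
  then have "real_of_int n > 0" using Tpos by (simp add: zero_less_mult_iff)
  then have npos: "n > 0" by simp
  have "is_minimal_period f (2*pi / real (nat n))"
    using minT eq npos by simp
  moreover have "q = nat n" if "q > 0" "is_minimal_period f (2*pi / real q)" for q
  proof -
    have "2*pi / real q = T"
      using that(2) minT unfolding is_minimal_period_def by (meson order_antisym)
    then have "real q * T = of_int n * T" using that(1) eq by (simp add: field_simps)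
    then have "real q = of_int n" using Tpos by simp
    then show ?thesis by linarith
  qed
  ultimately show ?thesis using npos by (intro ex1I[of _ "nat n"]) auto
qed

lemma abs_cont_deriv_vderiv2:
  assumes "u \<in> H2"
  shows "abs_cont_deriv (vderiv u) (vderiv2 u)"
proof -
  obtain w where "abs_cont_deriv (vderiv u) w" using assms by (auto simp: H2_def)
  then show ?thesis unfolding vderiv2_def by (metis someI)
qed

lemma vderiv2_square_integrable:
  assumes "u \<in> H2"
  shows "(\<lambda>t. (norm (vderiv2 u t))\<^sup>2) integrable_on {0..2*pi}"
proof -
  obtain w where w: "abs_cont_deriv (vderiv u) w" "(\<lambda>t. (norm (w t))\<^sup>2) integrable_on {0..2*pi}"
    using assms by (auto simp: H2_def)
  show ?thesis
    by (rule integrable_spike[OF w(2) abs_cont_deriv_unique[OF w(1) abs_cont_deriv_vderiv2[OF assms]]]) auto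
qed

lemma abs_cont_deriv_continuous:
  assumes "abs_cont_deriv v w"
  shows "continuous_on {a..b} v"
proof (cases "a \<le> b")
  case True
  have "w integrable_on {a..b}"
    using assms True by (auto simp: abs_cont_deriv_def absolutely_integrable_on_def)
  then have "continuous_on {a..b} (\<lambda>t. v a + integral {a..t} w)"
    by (intro continuous_intros indefinite_integral_continuous_1)
  moreover have "v a + integral {a..t} w = v t" if "t \<in> {a..b}" for t
  proof -
    have "v t - v a = integral {a..t} w" using assms that by (simp add: abs_cont_deriv_def)
    then show ?thesis by (metis add.commute diff_add_cancel)
  qed
  ultimately show ?thesis by (rule continuous_on_eq)
qed auto

lemma H2_continuous:
  assumes "u \<in> H2"
  shows "continuous_on {a..b} u" "continuous_on {a..b} (vderiv u)"
proof -
  show "continuous_on {a..b} u"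
    using assms by (auto simp: H2_def intro!: differentiable_imp_continuous_on
        differentiable_at_imp_differentiable_on)
  show "continuous_on {a..b} (vderiv u)"
    using abs_cont_deriv_continuous[OF abs_cont_deriv_vderiv2[OF assms]] .
qed

lemma vderiv_diff:
  assumes "u \<in> H2" "v \<in> H2"
  shows "vderiv (\<lambda>t. u t - v t) = (\<lambda>t. vderiv u t - vderiv v t)"
  using assms by (auto simp: H2_def fun_eq_iff)

lemma abs_cont_deriv_diff:
  assumes "abs_cont_deriv v w" "abs_cont_deriv v' w'"
  shows "abs_cont_deriv (\<lambda>t. v t - v' t) (\<lambda>t. w t - w' t)"
  using assms unfolding abs_cont_deriv_def
  by (auto simp: absolutely_integrable_on_def integral_diff algebra_simps
      intro!: set_integral_diff absolutely_integrable_on_def[THEN iffD1])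

definition jet :: "(real \<Rightarrow> real^3) \<Rightarrow> real \<Rightarrow> (real^3) \<times> (real^3) \<times> (real^3)" where
  "jet u t = (u t, vderiv u t, vderiv2 u t)"

lemma norm_jet: "(norm (jet u t))\<^sup>2 = (norm (u t))\<^sup>2 + (norm (vderiv u t))\<^sup>2 + (norm (vderiv2 u t))\<^sup>2"
  by (simp add: jet_def norm_Pair)

lemma H2_norm_jet: "H2_norm u = sqrt (integral {0..2*pi} (\<lambda>t. (norm (jet u t))\<^sup>2))"
  by (simp add: H2_norm_def norm_jet)

lemma jet_square_integrable:
  assumes "u \<in> H2"
  shows "(\<lambda>t. (norm (jet u t))\<^sup>2) integrable_on {0..2*pi}"
  unfolding norm_jet
  by (intro integrable_add vderiv2_square_integrable integrable_continuous_interval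
      continuous_intros H2_continuous assms)

lemma H2_diff:
  assumes "u \<in> H2" "v \<in> H2"
  shows "(\<lambda>t. u t - v t) \<in> H2"
proof -
  let ?w = "\<lambda>t. vderiv2 u t - vderiv2 v t"
  have ac: "abs_cont_deriv (vderiv (\<lambda>t. u t - v t)) ?w"
    unfolding vderiv_diff[OF assms]
    by (intro abs_cont_deriv_diff abs_cont_deriv_vderiv2 assms)
  have "(\<lambda>t. (norm (?w t))\<^sup>2) integrable_on {0..2*pi}"
  proof (rule measurable_bounded_by_integrable_imp_integrable)
    have "?w absolutely_integrable_on {0..2*pi}" using ac by (simp add: abs_cont_deriv_def)
    then have "?w \<in> borel_measurable (lebesgue_on {0..2*pi})"
      by (simp add: absolutely_integrable_measurable)
    then show "(\<lambda>t. (norm (?w t))\<^sup>2) \<in> borel_measurable (lebesgue_on {0..2*pi})" by measurable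
    show "(\<lambda>t. 2 * (norm (vderiv2 u t))\<^sup>2 + 2 * (norm (vderiv2 v t))\<^sup>2) integrable_on {0..2*pi}"
      by (intro integrable_add integrable_on_mult_right vderiv2_square_integrable assms)
    fix t
    have "(norm (?w t))\<^sup>2 \<le> (norm (vderiv2 u t) + norm (vderiv2 v t))\<^sup>2"
      by (intro power_mono norm_triangle_ineq4) auto
    also have "\<dots> \<le> 2 * (norm (vderiv2 u t))\<^sup>2 + 2 * (norm (vderiv2 v t))\<^sup>2"
      using sum_squares_bound[of "norm (vderiv2 u t)" "norm (vderiv2 v t)"]
      by (simp add: power2_sum)
    finally show "norm ((norm (?w t))\<^sup>2) \<le> \<dots>" by simp
  qed auto
  with ac show ?thesis
    using assms by (auto simp: H2_def has_period_def)
qed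

lemma jet_diff:
  assumes "u \<in> H2" "v \<in> H2"
  shows "negligible {t. jet (\<lambda>t. u t - v t) t \<noteq> jet u t - jet v t}"
proof (rule negligible_subset)
  show "negligible {t. vderiv2 (\<lambda>t. u t - v t) t \<noteq> vderiv2 u t - vderiv2 v t}"
    using abs_cont_deriv_diff[OF assms[THEN abs_cont_deriv_vderiv2]]
      abs_cont_deriv_vderiv2[OF H2_diff[OF assms]]
    by (intro abs_cont_deriv_unique) (auto simp: vderiv_diff[OF assms])
qed (auto simp: jet_def fun_cong[OF vderiv_diff[OF assms]])

lemma H2_dist_jet:
  assumes "u \<in> H2" "v \<in> H2"
  shows "H2_dist u v = sqrt (integral {0..2*pi} (\<lambda>t. (norm (jet u t - jet v t))\<^sup>2))"
    and "(\<lambda>t. (norm (jet u t - jet v t))\<^sup>2) integrable_on {0..2*pi}"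
proof -
  show "H2_dist u v = sqrt (integral {0..2*pi} (\<lambda>t. (norm (jet u t - jet v t))\<^sup>2))"
    unfolding H2_dist_def H2_norm_jet using assms
    by (simp, intro arg_cong[of _ _ sqrt] integral_spike[OF jet_diff[OF assms]]) auto
  show "(\<lambda>t. (norm (jet u t - jet v t))\<^sup>2) integrable_on {0..2*pi}"
    by (rule integrable_spike[OF jet_square_integrable[OF H2_diff[OF assms]] jet_diff[OF assms]]) auto
qed

lemma minkowski_aux:
  fixes a b :: real and f g :: "'a::real_normed_vector"
  assumes "a > 0" "b > 0"
  shows "(norm (f + g))\<^sup>2 \<le> (1 + b/a) * (norm f)\<^sup>2 + (1 + a/b) * (norm g)\<^sup>2"
proof -
  have "(norm (f + g))\<^sup>2 \<le> (norm f + norm g)\<^sup>2"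
    by (intro power_mono norm_triangle_ineq) auto
  moreover have "0 \<le> (b * norm f - a * norm g)\<^sup>2 / (a * b)" using assms by simp
  moreover have "(b * norm f - a * norm g)\<^sup>2 / (a * b)
      = b/a * (norm f)\<^sup>2 + a/b * (norm g)\<^sup>2 - 2 * norm f * norm g"
    using assms by (simp add: field_simps power2_eq_square)
  ultimately show ?thesis by (simp add: power2_sum algebra_simps)
qed

lemma H2_dist_nonneg: "0 \<le> H2_dist u v"
  using H2_dist_jet[of u v] by (cases "u \<in> H2 \<and> v \<in> H2") (auto simp: H2_dist_def integral_nonneg)

lemma Metric_space_H2: "Metric_space H2 H2_dist"
proof
  show "0 \<le> H2_dist u v" for u v by (rule H2_dist_nonneg)
next
  fix u v
  show "H2_dist u v = H2_dist v u"
    using H2_dist_jet(1)[of u v] H2_dist_jet(1)[of v u]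
    by (cases "u \<in> H2 \<and> v \<in> H2") (auto simp: H2_dist_def norm_minus_commute)
next
  fix u v assume uv: "u \<in> H2" "v \<in> H2"
  show "H2_dist u v = 0 \<longleftrightarrow> u = v"
  proof
    assume "u = v"
    then show "H2_dist u v = 0" using H2_dist_jet(1)[OF uv] by simp
  next
    assume "H2_dist u v = 0"
    then have 0: "integral {0..2*pi} (\<lambda>t. (norm (jet u t - jet v t))\<^sup>2) = 0"
      by (simp add: H2_dist_jet uv)
    have c: "continuous_on {0..2*pi} (\<lambda>t. (norm (u t - v t))\<^sup>2)"
      by (intro continuous_intros H2_continuous uv)
    have "(norm (u t - v t))\<^sup>2 \<le> (norm (jet u t - jet v t))\<^sup>2" for t
      by (simp add: jet_def norm_Pair)
    then have "integral {0..2*pi} (\<lambda>t. (norm (u t - v t))\<^sup>2)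
        \<le> integral {0..2*pi} (\<lambda>t. (norm (jet u t - jet v t))\<^sup>2)"
      by (intro integral_le integrable_continuous_interval c H2_dist_jet(2) uv)
    moreover have "integral {0..2*pi} (\<lambda>t. (norm (u t - v t))\<^sup>2) \<ge> 0"
      by (intro integral_nonneg integrable_continuous_interval c) auto
    ultimately have "\<forall>t\<in>{0..2*pi}. (norm (u t - v t))\<^sup>2 = 0"
      using integral_eq_0_iff[OF c] 0 by simp
    then have eq: "u t = v t" if "t \<in> {0..2*pi}" for t using that by auto
    show "u = v"
    proof
      fix t :: real
      define n where "n = \<lfloor>t / (2*pi)\<rfloor>"
      define s where "s = t - of_int n * (2*pi)"
      have "of_int n * (2*pi) \<le> t" "t < (of_int n + 1) * (2*pi)"
        unfolding n_def by (simp_all add: pos_le_divide_eq[symmetric] pos_divide_less_eq[symmetric])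
      then have "s \<in> {0..2*pi}" by (simp add: s_def algebra_simps)
      moreover have "has_period u (2*pi)" "has_period v (2*pi)" using uv by (auto simp: H2_def)
      ultimately show "u t = v t"
        using has_period_of_int[of u "2*pi" s n] has_period_of_int[of v "2*pi" s n] eq[of s]
        by (simp add: s_def)
    qed
  qed
next
  fix u v w assume uvw: "u \<in> H2" "v \<in> H2" "w \<in> H2"
  have "H2_dist u v \<ge> 0" "H2_dist v w \<ge> 0" by (simp_all add: H2_dist_nonneg)
  let ?f = "\<lambda>t. jet u t - jet v t" and ?g = "\<lambda>t. jet v t - jet w t"
  let ?I = "\<lambda>f. integral {0..2*pi} (\<lambda>t. (norm (f t))\<^sup>2)"
  have "H2_dist u w \<le> H2_dist u v + H2_dist v w + e" if "e > 0" for e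
  proof -
    define a b where "a = H2_dist u v + e/2" and "b = H2_dist v w + e/2"
    have ab: "a > 0" "b > 0" using \<open>H2_dist u v \<ge> 0\<close> \<open>H2_dist v w \<ge> 0\<close> that by (auto simp: a_def b_def)
    have Ia: "?I ?f \<le> a\<^sup>2" and Ib: "?I ?g \<le> b\<^sup>2"
      using ab that H2_dist_jet(1)[OF uvw(1,2)] H2_dist_jet(1)[OF uvw(2,3)]
      by (auto simp: a_def b_def intro!: sqrt_le_D)
    have "?I (\<lambda>t. jet u t - jet w t) \<le>
        integral {0..2*pi} (\<lambda>t. (1 + b/a) * (norm (?f t))\<^sup>2 + (1 + a/b) * (norm (?g t))\<^sup>2)"
    proof (intro integral_le H2_dist_jet(2) integrable_add integrable_on_mult_right uvw)
      fix t
      show "(norm (jet u t - jet w t))\<^sup>2 \<le> (1 + b/a) * (norm (?f t))\<^sup>2 + (1 + a/b) * (norm (?g t))\<^sup>2"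
        using minkowski_aux[OF ab, of "?f t" "?g t"] by simp
    qed
    also have "\<dots> = (1 + b/a) * ?I ?f + (1 + a/b) * ?I ?g"
      by (subst integral_add) (auto intro!: integrable_on_mult_right H2_dist_jet(2) uvw)
    also have "\<dots> \<le> (1 + b/a) * a\<^sup>2 + (1 + a/b) * b\<^sup>2"
      using ab Ia Ib by (intro add_mono mult_left_mono) auto
    also have "\<dots> = (a + b)\<^sup>2" using ab by (simp add: field_simps power2_eq_square)
    finally have "H2_dist u w \<le> a + b"
      using ab H2_dist_jet(1)[OF uvw(1,3)] by (simp add: real_le_lsqrt real_sqrt_le_iff)
    then show ?thesis by (simp add: a_def b_def)
  qed
  then show "H2_dist u w \<le> H2_dist u v + H2_dist v w"
    by (rule field_le_epsilon)
qed

end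

(* Convergence in H^2 of the circle implies convergence of functions and first derivatives,
   uniformly. The degree p is the winding number around 0 of the loop (x_1, x_2), which avoids 0
   because |x_3| < R = |x|; nearby loops have the same winding number.

   For q, solve the equation for x'' (so that x is C^2), and derive (u')^2 = P(u) and
   u'' = P'(u)/2 for u = x_3. By uniqueness for the latter equation, two points with equal values
   of (u, u') differ by a period. Fix a level c = u(t_0) with u'(t_0) > 0. By the first equation u'
   takes the same value at all points where u = c and u' > 0, so these points form the coset
   t_0 + T Z, where T is the minimal period. A C^1-small perturbation moves these crossings only
   slightly and creates no new ones, so T = 2 pi / q depends continuously on u, and q, an integer,
   is locally constant. *)

theory Submission
  imports Defs "HOL-Complex_Analysis.Winding_Numbers"
begin

subsection \<open>Convergence in \<open>H\<^sup>2\<close> controls the first derivative\<close>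

lemma H2_has_vector_derivative:
  assumes "u \<in> H2"
  shows "(u has_vector_derivative vderiv u t) (at t)"
  using assms by (simp add: H2_def vector_derivative_works)

lemma vector_derivative_has_period:
  assumes "\<And>t. (u has_vector_derivative v t) (at t)" and "has_period u T"
  shows "has_period v T"
  unfolding has_period_def
proof
  fix t
  have "((u \<circ> (\<lambda>s. s + T)) has_vector_derivative 1 *\<^sub>R v (t + T)) (at t)"
    by (rule vector_diff_chain_at) (auto intro!: derivative_eq_intros assms(1))
  moreover have "u \<circ> (\<lambda>s. s + T) = u"
    using assms(2) by (simp add: has_period_def fun_eq_iff)
  ultimately show "v (t + T) = v t"
    using vector_derivative_unique_at[OF assms(1)] by fastforce
qed

lemma abs_cont_deriv_continuous_on:
  assumes "abs_cont_deriv v w"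
  shows "continuous_on S v"
proof -
  have "isCont v t" for t
    using abs_cont_deriv_continuous[OF assms, of "t - 1" "t + 1"]
      continuous_on_interior[of "{t-1..t+1}" v t] by simp
  then show ?thesis by (simp add: continuous_at_imp_continuous_on)
qed

lemma H2_continuous_on:
  assumes "u \<in> H2"
  shows "continuous_on S u" "continuous_on S (vderiv u)"
  using assms abs_cont_deriv_continuous_on[OF abs_cont_deriv_vderiv2[OF assms]]
  by (auto simp: H2_def intro!: differentiable_imp_continuous_on
      differentiable_at_imp_differentiable_on)

lemma has_period_reduce:
  fixes f :: "real \<Rightarrow> 'a"
  assumes "has_period f T" "T > 0"
  obtains s where "s \<in> {0..T}" "f t = f s"
proof -
  define n where "n = \<lfloor>t / T\<rfloor>"
  have "of_int n * T \<le> t" "t < (of_int n + 1) * T"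
    unfolding n_def using assms(2)
    by (simp_all add: pos_le_divide_eq[symmetric] pos_divide_less_eq[symmetric])
  then show thesis
    using that[of "t - of_int n * T"] has_period_of_int[OF assms(1), of "t - of_int n * T" n]
    by (simp add: algebra_simps)
qed

text \<open>One-dimensional Sobolev embedding with an explicit constant. Smallness in mean square
  gives a point \<open>s\<close> with \<open>norm (y s) < e\<close>, and every increment of
  \<open>y\<close> is an integral of \<open>w\<close>, hence at most \<open>(1/2 + pi) * e\<close>.
  The factor 6 is a crude bound for the sum of both contributions.\<close>

lemma sup_bound_of_square_integrals:
  fixes y w :: "real \<Rightarrow> 'a::euclidean_space"
  assumes e: "e > 0" and cont: "continuous_on {0..2*pi} y"
    and ftc: "\<And>s t. \<lbrakk>0 \<le> s; s \<le> t; t \<le> 2*pi\<rbrakk> \<Longrightarrow> (w has_integral y t - y s) {s..t}"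
    and w2: "(\<lambda>t. (norm (w t))\<^sup>2) integrable_on {0..2*pi}"
    and Iy: "integral {0..2*pi} (\<lambda>t. (norm (y t))\<^sup>2) < e\<^sup>2"
    and Iw: "integral {0..2*pi} (\<lambda>t. (norm (w t))\<^sup>2) < e\<^sup>2"
    and t: "t \<in> {0..2*pi}"
  shows "norm (y t) < 6 * e"
proof -
  have pi3: "3 < pi" "pi < 4" using pi_gt3 pi_less_4 by auto
  obtain s where s: "s \<in> {0..2*pi}" "norm (y s) < e"
  proof (rule ccontr)
    assume "\<not> thesis"
    then have "e \<le> norm (y s)" if "s \<in> {0..2*pi}" for s using that \<open>\<And>s. _ \<Longrightarrow> _ \<Longrightarrow> thesis\<close> by force
    then have "integral {0..2*pi} (\<lambda>t. e\<^sup>2) \<le> integral {0..2*pi} (\<lambda>t. (norm (y t))\<^sup>2)"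
      using e by (intro integral_le integrable_continuous_interval continuous_intros cont power_mono) auto
    \<comment> \<open>The interval has length 2 pi > 1, so a function of norm at least
      \<open>e\<close> throughout has square integral at least \<open>e^2\<close>.\<close>
    moreover have "1 * e\<^sup>2 \<le> 2 * pi * e\<^sup>2"
      using pi3 by (intro mult_right_mono) auto
    ultimately show False using Iy by simp
  qed
  have diff: "norm (y b - y a) \<le> (1/2 + pi) * e" if ab: "0 \<le> a" "a \<le> b" "b \<le> 2*pi" for a b
  proof -
    have "{a..b} \<subseteq> {0..2*pi}" using ab by auto
    then have i: "(\<lambda>t. (norm (w t))\<^sup>2) integrable_on {a..b}"
      by (rule integrable_on_subinterval[OF w2])
    \<comment> \<open>Young's inequality, with weight chosen so that both terms are of order
      \<open>e\<close> after integration, takes the place of Cauchy-Schwarz.\<close>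
    have "norm (integral {a..b} w) \<le> integral {a..b} (\<lambda>t. 1/(2*e) * (norm (w t))\<^sup>2 + e/2)"
    proof (rule integral_norm_bound_integral)
      show "w integrable_on {a..b}" using ftc[OF ab] by blast
      show "(\<lambda>t. 1/(2*e) * (norm (w t))\<^sup>2 + e/2) integrable_on {a..b}"
        by (intro integrable_add integrable_on_mult_right i integrable_const_ivl)
      fix t
      have "0 \<le> (norm (w t) - e)\<^sup>2 / (2*e)" using e by simp
      then show "norm (w t) \<le> 1/(2*e) * (norm (w t))\<^sup>2 + e/2"
        using e by (simp add: field_simps power2_eq_square)
    qed
    also have "\<dots> = 1/(2*e) * integral {a..b} (\<lambda>t. (norm (w t))\<^sup>2) + e/2 * (b - a)"
      using ab by (subst integral_add[OF integrable_on_mult_right[OF i] integrable_const_ivl]) simp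
    also have "\<dots> \<le> 1/(2*e) * e\<^sup>2 + e/2 * (2*pi)"
    proof (intro add_mono mult_left_mono)
      have "integral {a..b} (\<lambda>t. (norm (w t))\<^sup>2) \<le> integral {0..2*pi} (\<lambda>t. (norm (w t))\<^sup>2)"
        using i w2 ab by (intro integral_subset_le) auto
      then show "integral {a..b} (\<lambda>t. (norm (w t))\<^sup>2) \<le> e\<^sup>2" using Iw by simp
    qed (use e ab in auto)
    also have "\<dots> = (1/2 + pi) * e"
      using e by (simp add: field_simps power2_eq_square)
    finally have "norm (integral {a..b} w) \<le> (1/2 + pi) * e" .
    then show ?thesis using ftc[OF ab] by (simp add: integral_unique)
  qed
  have "norm (y t - y s) \<le> (1/2 + pi) * e"
    using diff[of s t] diff[of t s] s(1) t by (cases "s \<le> t") (auto simp: norm_minus_commute)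
  moreover have "(1/2 + pi) * e \<le> 5 * e" using e pi3 by (intro mult_right_mono) auto
  ultimately show ?thesis
    using s(2) norm_triangle_sub[of "y t" "y s"] by linarith
qed

text \<open>The Sobolev bound is applied twice, to \<open>u - v\<close> with its derivative and to
  the first derivatives with the second ones. Periodicity extends the bounds from one period to all
  \<open>t\<close>.\<close>

lemma H2_dist_imp_C1_close:
  assumes uv: "u \<in> H2" "v \<in> H2" and e: "e > 0" and d: "H2_dist u v < e"
  shows "norm (u t - v t) < 6 * e" "norm (vderiv u t - vderiv v t) < 6 * e"
proof -
  define f where "f = (\<lambda>t. u t - v t)"
  define f' where "f' = (\<lambda>t. vderiv u t - vderiv v t)"
  define f'' where "f'' = (\<lambda>t. vderiv2 u t - vderiv2 v t)"
  let ?J = "\<lambda>t. (norm (jet u t - jet v t))\<^sup>2"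
  have J: "?J integrable_on {0..2*pi}" by (rule H2_dist_jet(2)[OF uv])
  have "integral {0..2*pi} ?J \<ge> 0" by (intro integral_nonneg J) auto
  then have IJ: "integral {0..2*pi} ?J < e\<^sup>2"
    using d e H2_dist_jet(1)[OF uv] real_sqrt_less_iff[of "integral {0..2*pi} ?J" "e\<^sup>2"] by simp
  have Jeq: "?J t = (norm (f t))\<^sup>2 + (norm (f' t))\<^sup>2 + (norm (f'' t))\<^sup>2" for t
    by (simp add: jet_def norm_Pair f_def f'_def f''_def)
  have cf: "continuous_on S f" and cf': "continuous_on S f'" for S
    unfolding f_def f'_def
    by (intro continuous_intros H2_continuous_on uv)+
  have i: "(\<lambda>t. (norm (f t))\<^sup>2) integrable_on {0..2*pi}" "(\<lambda>t. (norm (f' t))\<^sup>2) integrable_on {0..2*pi}"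
    by (intro integrable_continuous_interval continuous_intros cf cf')+
  \<comment> \<open>The second-order term is what remains of the integrable jet after the two
    continuous terms are subtracted.\<close>
  have i'': "(\<lambda>t. (norm (f'' t))\<^sup>2) integrable_on {0..2*pi}"
    using integrable_diff[OF J integrable_add[OF i]] unfolding Jeq by simp
  have I: "integral {0..2*pi} (\<lambda>t. (norm (g t))\<^sup>2) < e\<^sup>2"
    if "(\<lambda>t. (norm (g t))\<^sup>2) integrable_on {0..2*pi}" "\<And>t. (norm (g t))\<^sup>2 \<le> ?J t"
    for g :: "real \<Rightarrow> real^3"
    using integral_le[OF that(1) J] that(2) IJ by fastforce
  have df: "(f has_vector_derivative f' t) (at t)" for t
    unfolding f_def f'_def by (intro derivative_intros H2_has_vector_derivative uv)
  have ftc1: "(f' has_integral f t - f s) {s..t}" if "s \<le> t" for s t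
    by (rule fundamental_theorem_of_calculus[OF that]) (rule has_vector_derivative_at_within[OF df])
  have "abs_cont_deriv f' f''"
    unfolding f'_def f''_def by (intro abs_cont_deriv_diff abs_cont_deriv_vderiv2 uv)
  then have ftc2: "(f'' has_integral f' t - f' s) {s..t}" if "s \<le> t" for s t
    using that by (simp add: abs_cont_deriv_def absolutely_integrable_on_def has_integral_iff)
  have pf: "has_period f (2*pi)" using uv by (simp add: f_def H2_def has_period_def)
  then have pf': "has_period f' (2*pi)" using df by (rule vector_derivative_has_period[rotated])
  obtain s where "s \<in> {0..2*pi}" "f t = f s" by (rule has_period_reduce[OF pf]) auto
  then show "norm (u t - v t) < 6 * e"
    using sup_bound_of_square_integrals[OF e cf ftc1 i(2) I[OF i(1)] I[OF i(2)], of s]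
    by (simp add: Jeq f_def)
  obtain s where "s \<in> {0..2*pi}" "f' t = f' s" by (rule has_period_reduce[OF pf']) auto
  then show "norm (vderiv u t - vderiv v t) < 6 * e"
    using sup_bound_of_square_integrals[OF e cf' ftc2 i'' I[OF i(2)] I[OF i''], of s]
    by (simp add: Jeq f'_def)
qed

subsection \<open>Classical regularity on the zero set\<close>

text \<open>Lebesgue differentiation, in the form that averages over \<open>[x, x + h]\<close>.
  One-sided derivatives are enough later, where they serve only to differentiate an identity between
  functions.\<close>

lemma abs_cont_deriv_right_derivative_ae:
  assumes "abs_cont_deriv v w"
  obtains N where "negligible N"
    and "\<And>t. t \<notin> N \<Longrightarrow> (v has_vector_derivative w t) (at t within {t..})"
proof -
  have "w integrable_on {s..t}" for s t
    using assms unfolding abs_cont_deriv_def absolutely_integrable_on_def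
    by (cases "s \<le> t"; force)
  then have "w integrable_on cbox s t" for s t by simp
  then obtain N where N: "negligible N"
    and N': "\<And>x e. \<lbrakk>x \<notin> N; 0 < e\<rbrakk> \<Longrightarrow> \<exists>d>0. \<forall>h. 0 < h \<and> h < d \<longrightarrow>
               norm (integral (cbox x (x + h *\<^sub>R One)) w /\<^sub>R h ^ DIM(real) - w x) < e"
    using integrable_ccontinuous_explicit[of w] by metis
  have "(v has_vector_derivative w x) (at x within {x..})" if x: "x \<notin> N" for x
    unfolding has_vector_derivative_def has_derivative_within_alt
  proof (intro conjI allI impI)
    show "bounded_linear (\<lambda>h. h *\<^sub>R w x)" by (rule bounded_linear_scaleR_left)
    fix e :: real assume "e > 0"
    then obtain d where d: "d > 0" "\<And>h. 0 < h \<and> h < d \<Longrightarrow>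
        norm (integral (cbox x (x + h *\<^sub>R One)) w /\<^sub>R h ^ DIM(real) - w x) < e"
      using N'[OF x] by blast
    have "norm (v y - v x - (y - x) *\<^sub>R w x) \<le> e * norm (y - x)"
      if y: "y \<in> {x..}" "norm (y - x) < d" for y
    proof (cases "y = x")
      case False
      define h where "h = y - x"
      have h: "0 < h" "h < d" "y = x + h" using y False by (auto simp: h_def)
      have "v y - v x = integral {x..y} w" using assms y by (simp add: abs_cont_deriv_def)
      then have "norm ((v y - v x) /\<^sub>R h - w x) < e" using d(2)[of h] h by simp
      then have "h * norm ((v y - v x) /\<^sub>R h - w x) \<le> h * e" using h by simp
      moreover have "v y - v x - h *\<^sub>R w x = h *\<^sub>R ((v y - v x) /\<^sub>R h - w x)"
        using h by (simp add: scaleR_diff_right)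
      ultimately show ?thesis using h by (simp add: mult.commute)
    qed simp
    with d(1) show "\<exists>d>0. \<forall>y\<in>{x..}. norm (y - x) < d \<longrightarrow>
        norm (v y - v x - (y - x) *\<^sub>R w x) \<le> e * norm (y - x)" by blast
  qed
  with N that show thesis by blast
qed

section \<open>Derivatives of the circle and of the curve x_0 + u\<close>

lemma circle_curve_derivs:
  shows "(circle_curve R has_vector_derivative vector [- R * sin t, R * cos t, 0]) (at t)"
    and "((\<lambda>t. vector [- R * sin t, R * cos t, 0] :: real^3) has_vector_derivative
           - circle_curve R t) (at t)"
proof -
  have eq: "vector [a, b, 0] = a *\<^sub>R axis 1 1 + b *\<^sub>R (axis 2 1 :: real^3)" for a b :: real
    by (simp add: vec_eq_iff forall_3 axis_def)
  have "((\<lambda>t. (R * cos t) *\<^sub>R axis 1 1 + (R * sin t) *\<^sub>R (axis 2 1 :: real^3)) has_vector_derivative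
      (- R * sin t) *\<^sub>R axis 1 1 + (R * cos t) *\<^sub>R axis 2 1) (at t)"
    by (auto intro!: derivative_eq_intros simp: mult.commute)
  then show "(circle_curve R has_vector_derivative vector [- R * sin t, R * cos t, 0]) (at t)"
    unfolding eq circle_curve_def[abs_def] .
  have "((\<lambda>t. (- R * sin t) *\<^sub>R axis 1 1 + (R * cos t) *\<^sub>R (axis 2 1 :: real^3)) has_vector_derivative
      - ((R * cos t) *\<^sub>R axis 1 1 + (R * sin t) *\<^sub>R axis 2 1)) (at t)"
    by (auto intro!: derivative_eq_intros simp: mult.commute)
  then show "((\<lambda>t. vector [- R * sin t, R * cos t, 0] :: real^3) has_vector_derivative
           - circle_curve R t) (at t)"
    unfolding eq circle_curve_def .
qed

lemma curve_has_vector_derivative: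
  assumes "u \<in> H2"
  shows "(curve R u has_vector_derivative vector [- R * sin t, R * cos t, 0] + vderiv u t) (at t)"
  unfolding curve_def[abs_def]
  by (intro derivative_intros circle_curve_derivs H2_has_vector_derivative assms)

lemma vderiv_curve:
  assumes "u \<in> H2"
  shows "vderiv (curve R u) = (\<lambda>t. vector [- R * sin t, R * cos t, 0] + vderiv u t)"
  using vector_derivative_at[OF curve_has_vector_derivative[OF assms]] by blast

text \<open>The choice made by \<open>vderiv2 (curve R u)\<close> is meaningful once one admissible
  second derivative is exhibited; the sum of \<open>- circle_curve R t\<close> and
  \<open>vderiv2 u t\<close> is one.\<close>

lemma abs_cont_deriv_curve:
  assumes "u \<in> H2"
  shows "abs_cont_deriv (vderiv (curve R u)) (vderiv2 (curve R u))"
proof -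
  let ?c = "\<lambda>t. vector [- R * sin t, R * cos t, 0] :: real^3"
  have u: "abs_cont_deriv (vderiv u) (vderiv2 u)" by (rule abs_cont_deriv_vderiv2[OF assms])
  have cont: "continuous_on S (\<lambda>t. - circle_curve R t)" for S
    by (intro continuous_intros differentiable_imp_continuous_on differentiable_at_imp_differentiable_on
        differentiableI_vector[OF circle_curve_derivs(1)])
  have "abs_cont_deriv (vderiv (curve R u)) (\<lambda>t. - circle_curve R t + vderiv2 u t)"
    unfolding abs_cont_deriv_def
  proof (intro allI impI conjI)
    fix s t :: real assume st: "s \<le> t"
    have a: "vderiv2 u absolutely_integrable_on {s..t}"
      using u st by (simp add: abs_cont_deriv_def)
    have c: "(\<lambda>t. - circle_curve R t) absolutely_integrable_on {s..t}"
      by (intro absolutely_integrable_continuous_real cont)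
    show "(\<lambda>t. - circle_curve R t + vderiv2 u t) absolutely_integrable_on {s..t}"
      using c a by (rule set_integral_add(1))
    have "((\<lambda>t. - circle_curve R t) has_integral ?c t - ?c s) {s..t}"
      by (rule fundamental_theorem_of_calculus[OF st])
        (rule has_vector_derivative_at_within[OF circle_curve_derivs(2)])
    moreover have "(vderiv2 u has_integral vderiv u t - vderiv u s) {s..t}"
      using u st by (simp add: abs_cont_deriv_def absolutely_integrable_on_def has_integral_iff)
    ultimately have "((\<lambda>t. - circle_curve R t + vderiv2 u t) has_integral
        ((?c t - ?c s) + (vderiv u t - vderiv u s))) {s..t}"
      by (rule has_integral_add)
    then show "vderiv (curve R u) t - vderiv (curve R u) s =
        integral {s..t} (\<lambda>t. - circle_curve R t + vderiv2 u t)"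
      by (simp add: integral_unique algebra_simps fun_cong[OF vderiv_curve[OF assms]])
  qed
  then show ?thesis unfolding vderiv2_def[of "curve R u"] by (rule someI[of "abs_cont_deriv (vderiv (curve R u))"])
qed

text \<open>The equation of motion solved for \<open>x''\<close>: take the cross product with \<open>x\<close>, apply the
  Lagrange identity and use \<open>\<bar>x\<bar> = R\<close> and \<open>x \<bullet> x'' = - \<bar>x'\<bar>\<^sup>2\<close>.\<close>

definition accel :: "real \<Rightarrow> real \<Rightarrow> real^3 \<Rightarrow> real^3 \<Rightarrow> real^3" where
  "accel R \<mu> x v = (1 / R\<^sup>2) *\<^sub>R
     (- (v \<bullet> v) *\<^sub>R x - \<mu> *\<^sub>R (R\<^sup>2 *\<^sub>R axis 3 1 - (x $ 3) *\<^sub>R x) + \<mu> *\<^sub>R cross3 x v)"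

lemma accel_unique:
  assumes R: "R > 0" and xx: "x \<bullet> x = R\<^sup>2" and xw: "x \<bullet> w = - (v \<bullet> v)"
    and eq: "cross3 x w - \<mu> *\<^sub>R cross3 (axis 3 1) x + \<mu> *\<^sub>R v = 0"
  shows "w = accel R \<mu> x v"
proof -
  have e: "cross3 x w = \<mu> *\<^sub>R cross3 (axis 3 1) x - \<mu> *\<^sub>R v"
    using eq by (simp add: algebra_simps eq_neg_iff_add_eq_0)
  have "cross3 x (cross3 x w) = - (v \<bullet> v) *\<^sub>R x - R\<^sup>2 *\<^sub>R w"
    by (simp add: Lagrange xx xw)
  moreover have "cross3 x (cross3 x w) = \<mu> *\<^sub>R (R\<^sup>2 *\<^sub>R axis 3 1 - (x $ 3) *\<^sub>R x) - \<mu> *\<^sub>R cross3 x v"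
    unfolding e by (simp add: Cross3.right_diff_distrib cross_mult_right Lagrange xx inner_axis)
  ultimately have "R\<^sup>2 *\<^sub>R w =
      - (v \<bullet> v) *\<^sub>R x - \<mu> *\<^sub>R (R\<^sup>2 *\<^sub>R axis 3 1 - (x $ 3) *\<^sub>R x) + \<mu> *\<^sub>R cross3 x v"
    by (simp add: algebra_simps)
  then have "(1 / R\<^sup>2) *\<^sub>R (R\<^sup>2 *\<^sub>R w) = accel R \<mu> x v" by (simp add: accel_def)
  then show ?thesis using R by simp
qed

text \<open>Bootstrapping: almost everywhere the equation identifies x'' with a continuous function
  of x and x'. Since x' is an integral of x'', it is also an integral of that continuous function,
  so x is of class C^2 and the solved equation holds at every point.\<close>

lemma zero_set_derivs:
  assumes R: "R > 0" and z: "(\<mu>, u) \<in> zero_set R"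
    and x_def: "x = curve R u" and v_def: "v = vderiv (curve R u)"
  shows "(x has_vector_derivative v t) (at t)"
    and "(v has_vector_derivative accel R \<mu> (x t) (v t)) (at t)"
    and "x t \<bullet> x t = R\<^sup>2" and "x t \<bullet> v t = 0" and "\<mu> > 0"
proof -
  have u: "u \<in> H2" and nx: "\<And>t. norm (x t) = R" and "\<mu> > 0"
    and ae: "AE t in lebesgue. cross3 (x t) (vderiv2 x t)
          - \<mu> *\<^sub>R cross3 (axis 3 1) (x t) + \<mu> *\<^sub>R v t = 0"
    using z by (auto simp: zero_set_def x_def v_def)
  show "\<mu> > 0" by fact
  show dx: "(x has_vector_derivative v t) (at t)" for t
    using curve_has_vector_derivative[OF u] by (simp add: x_def v_def vderiv_curve[OF u])
  show xx: "x t \<bullet> x t = R\<^sup>2" for t using nx[of t] by (simp add: dot_square_norm)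
  show xv: "x t \<bullet> v t = 0" for t
  proof -
    have "((\<lambda>t. x t \<bullet> x t) has_vector_derivative (x t \<bullet> v t + v t \<bullet> x t)) (at t)"
      by (rule bounded_bilinear.has_vector_derivative[OF bounded_bilinear_inner dx dx])
    moreover have "((\<lambda>t. x t \<bullet> x t) has_vector_derivative 0) (at t)" by (simp add: xx)
    ultimately show ?thesis using vector_derivative_unique_at by (fastforce simp: inner_commute)
  qed
  have ac: "abs_cont_deriv v (vderiv2 x)"
    unfolding v_def x_def by (rule abs_cont_deriv_curve[OF u])
  obtain N1 where N1: "negligible N1"
    and d1: "\<And>t. t \<notin> N1 \<Longrightarrow> (v has_vector_derivative vderiv2 x t) (at t within {t..})"
    using abs_cont_deriv_right_derivative_ae[OF ac] by blast
  define N2 where "N2 = {t. cross3 (x t) (vderiv2 x t)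
          - \<mu> *\<^sub>R cross3 (axis 3 1) (x t) + \<mu> *\<^sub>R v t \<noteq> 0}"
  have N2: "negligible N2"
  proof -
    obtain N where "N \<in> null_sets lebesgue" "N2 \<subseteq> N"
      using ae unfolding N2_def eventually_ae_filter by auto
    then show ?thesis using negligible_subset[of N N2] by (simp add: negligible_iff_null_sets)
  qed
  have eq: "vderiv2 x t = accel R \<mu> (x t) (v t)" if t: "t \<notin> N1 \<union> N2" for t
  proof (rule accel_unique[OF R xx])
    \<comment> \<open>The product x . x' vanishes identically, so its right derivative is zero
      wherever x'' exists as a right derivative of x'. This supplies x . x'' = - |x'|^2.\<close>
    have "((\<lambda>s. x s \<bullet> v s) has_vector_derivative (x t \<bullet> vderiv2 x t + v t \<bullet> v t)) (at t within {t..})"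
      using t by (intro bounded_bilinear.has_vector_derivative[OF bounded_bilinear_inner
            has_vector_derivative_at_within[OF dx] d1]) auto
    moreover have "((\<lambda>s. x s \<bullet> v s) has_vector_derivative 0) (at t within {t..})" by (simp add: xv)
    moreover have "at t within {t..} \<noteq> bot"
      by (simp add: at_within_Ici_at_right)
    ultimately have "x t \<bullet> vderiv2 x t + v t \<bullet> v t = 0"
      using vector_derivative_unique_within by blast
    then show "x t \<bullet> vderiv2 x t = - (v t \<bullet> v t)" by simp
  qed (use t in \<open>auto simp: N2_def\<close>)
  have cx: "continuous_on UNIV x"
    using dx by (meson continuous_at_imp_continuous_on has_vector_derivative_continuous)
  have cv: "continuous_on S v" for S by (rule abs_cont_deriv_continuous_on[OF ac])
  have ca: "continuous_on S (\<lambda>t. accel R \<mu> (x t) (v t))" for S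
    unfolding accel_def
    by (intro continuous_intros continuous_on_cross cv continuous_on_subset[OF cx] subset_UNIV)
  have int: "v s - v a = integral {a..s} (\<lambda>t. accel R \<mu> (x t) (v t))" if "a \<le> s" for a s
  proof -
    have "v s - v a = integral {a..s} (vderiv2 x)"
      using ac that by (simp add: abs_cont_deriv_def)
    also have "\<dots> = integral {a..s} (\<lambda>t. accel R \<mu> (x t) (v t))"
      by (rule integral_spike[OF negligible_Un[OF N1 N2]]) (use eq in auto)
    finally show ?thesis .
  qed
  show "(v has_vector_derivative accel R \<mu> (x t) (v t)) (at t)"
  proof -
    have "((\<lambda>s. v (t - 1) + integral {t-1..s} (\<lambda>t. accel R \<mu> (x t) (v t))) has_vector_derivative
        accel R \<mu> (x t) (v t)) (at t within {t-1..t+1})"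
      by (auto intro!: derivative_eq_intros integral_has_vector_derivative ca)
    then have "(v has_vector_derivative accel R \<mu> (x t) (v t)) (at t within {t-1..t+1})"
      by (rule has_vector_derivative_transform[rotated 2]) (use int in \<open>auto simp: algebra_simps\<close>)
    then show ?thesis by (simp add: at_within_Icc_at)
  qed
qed

subsection \<open>Minimal periods of one-dimensional autonomous motions\<close>

text \<open>Gronwall's argument: the weight \<open>exp (- (1 + L) * t)\<close> makes the energy
  \<open>d^2 + d'^2\<close> nonincreasing, and the energy starts at zero.\<close>

lemma linear_second_order_zero:
  fixes d d' :: "real \<Rightarrow> real"
  assumes d: "\<And>t. (d has_real_derivative d' t) (at t)"
    and d': "\<And>t. (d' has_real_derivative k t * d t) (at t)"
    and k: "\<And>t. \<bar>k t\<bar> \<le> L"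
    and init: "d a = 0" "d' a = 0" and t: "a \<le> t"
  shows "d t = 0"
proof -
  define \<phi> where "\<phi> = (\<lambda>t. ((d t)\<^sup>2 + (d' t)\<^sup>2) * exp (- (1 + L) * t))"
  have "\<phi> t \<le> \<phi> a"
  proof (rule DERIV_nonpos_imp_nonincreasing[OF t])
    fix s
    have "(\<phi> has_real_derivative ((2 * d s * d' s + 2 * d' s * (k s * d s))
        - (1 + L) * ((d s)\<^sup>2 + (d' s)\<^sup>2)) * exp (- (1 + L) * s)) (at s)"
      unfolding \<phi>_def by (auto intro!: derivative_eq_intros d d' simp: algebra_simps power2_eq_square)
    moreover have "2 * d s * d' s + 2 * d' s * (k s * d s) \<le> (1 + L) * ((d s)\<^sup>2 + (d' s)\<^sup>2)"
    proof -
      have "2 * d s * d' s + 2 * d' s * (k s * d s) = (1 + k s) * (2 * d s * d' s)"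
        by (simp add: algebra_simps)
      also have "\<dots> \<le> \<bar>1 + k s\<bar> * \<bar>2 * d s * d' s\<bar>"
        by (metis abs_ge_self abs_mult)
      also have "\<dots> \<le> (1 + L) * ((d s)\<^sup>2 + (d' s)\<^sup>2)"
      proof (rule mult_mono)
        show "\<bar>1 + k s\<bar> \<le> 1 + L" using k[of s] by linarith
        show "\<bar>2 * d s * d' s\<bar> \<le> (d s)\<^sup>2 + (d' s)\<^sup>2"
          using sum_squares_bound[of "\<bar>d s\<bar>" "\<bar>d' s\<bar>"] by (simp add: abs_mult)
        show "0 \<le> 1 + L" using k[of s] by linarith
      qed simp
      finally show ?thesis .
    qed
    ultimately show "\<exists>y. (\<phi> has_real_derivative y) (at s) \<and> y \<le> 0"
      by (intro exI conjI) (auto intro!: mult_nonpos_nonneg)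
  qed
  then have "(d t)\<^sup>2 + (d' t)\<^sup>2 \<le> 0" by (simp add: \<phi>_def init mult_le_0_iff not_le)
  then show ?thesis by (metis add_le_same_cancel1 order_trans power2_eq_iff_nonneg sum_power2_le_zero_iff)
qed

text \<open>These are the consequences of \<open>(f')^2 = P(f)\<close> and of uniqueness for
  \<open>f'' = P'(f)/2\<close> on which the period argument rests: equal heights give equal speeds,
  and equal phase points differ by a period. The polynomial itself is left out, so two motions can
  be compared without comparing their polynomials.\<close>

definition autonomous_motion :: "(real \<Rightarrow> real) \<Rightarrow> (real \<Rightarrow> real) \<Rightarrow> bool" where
  "autonomous_motion f f' \<longleftrightarrow>
     (\<forall>t. (f has_real_derivative f' t) (at t)) \<and> continuous_on UNIV f' \<and>
     (\<forall>s t. f s = f t \<longrightarrow> (f' s)\<^sup>2 = (f' t)\<^sup>2) \<and>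
     (\<forall>s t. f s = f t \<and> f' s = f' t \<longrightarrow> has_period f (t - s))"

lemma autonomous_motionI:
  fixes f f' :: "real \<Rightarrow> real"
  assumes f: "\<And>t. (f has_real_derivative f' t) (at t)"
    and f': "\<And>t. (f' has_real_derivative \<alpha> * (f t)\<^sup>2 + \<beta> * f t + \<gamma>) (at t)"
    and energy: "\<And>t. (f' t)\<^sup>2 = P (f t)"
    and bdd: "\<And>t. \<bar>f t\<bar> \<le> M"
    and per: "has_period f T" "T > 0"
  shows "autonomous_motion f f'"
  unfolding autonomous_motion_def
proof (intro conjI allI impI)
  show "continuous_on UNIV f'"
    using f' by (meson DERIV_isCont continuous_at_imp_continuous_on)
  fix s t
  assume st: "f s = f t \<and> f' s = f' t"
  have shift: "((\<lambda>r. f (r + c)) has_real_derivative f' (r + c)) (at r)"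
    "((\<lambda>r. f' (r + c)) has_real_derivative \<alpha> * (f (r + c))\<^sup>2 + \<beta> * f (r + c) + \<gamma>) (at r)" for r c
    using f[of "r + c"] f'[of "r + c"] by (simp_all only: DERIV_shift)
  define d where "d = (\<lambda>r. f (r + t) - f (r + s))"
  define d' where "d' = (\<lambda>r. f' (r + t) - f' (r + s))"
  \<comment> \<open>The divided difference of the quadratic right-hand side: the difference of two
    translates solves a linear equation with this bounded coefficient.\<close>
  define k where "k = (\<lambda>r. \<alpha> * (f (r + t) + f (r + s)) + \<beta>)"
  have "d r = 0" if "0 \<le> r" for r
  proof (rule linear_second_order_zero[OF _ _ _ _ _ that])
    fix r
    show "(d has_real_derivative d' r) (at r)"
      unfolding d_def d'_def by (intro DERIV_diff shift)
    have "(d' has_real_derivative (\<alpha> * (f (r+t))\<^sup>2 + \<beta> * f (r+t) + \<gamma>) - (\<alpha> * (f (r+s))\<^sup>2 + \<beta> * f (r+s) + \<gamma>)) (at r)"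
      unfolding d'_def by (intro DERIV_diff shift)
    then show "(d' has_real_derivative k r * d r) (at r)"
      by (simp add: k_def d_def algebra_simps power2_eq_square)
    have "\<bar>\<alpha> * (f (r + t) + f (r + s))\<bar> \<le> \<bar>\<alpha>\<bar> * (2 * M)"
      unfolding abs_mult using bdd[of "r+t"] bdd[of "r+s"] by (intro mult_left_mono) auto
    then show "\<bar>k r\<bar> \<le> \<bar>\<alpha>\<bar> * (2 * M) + \<bar>\<beta>\<bar>"
      unfolding k_def by linarith
  qed (use st in \<open>auto simp: d_def d'_def\<close>)
  then have eq: "f (r + t) = f (r + s)" if "0 \<le> r" for r using that by (simp add: d_def)
  show "has_period f (t - s)"
    unfolding has_period_def
  proof
    fix r
    \<comment> \<open>The translates are known to agree only for nonnegative arguments; adding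
      \<open>n\<close> periods moves an arbitrary \<open>r - s\<close> there.\<close>
    obtain n :: nat where "real n * T > \<bar>r - s\<bar>"
      using reals_Archimedean3[OF per(2)] by blast
    then have n: "r + of_int (int n) * T - s \<ge> 0" by simp
    have "f (r + (t - s)) = f (r + (t - s) + of_int (int n) * T)"
      by (rule has_period_of_int[OF per(1), symmetric])
    also have "\<dots> = f ((r + of_int (int n) * T - s) + t)" by (simp add: algebra_simps)
    also have "\<dots> = f ((r + of_int (int n) * T - s) + s)" by (rule eq[OF n])
    also have "\<dots> = f r" using has_period_of_int[OF per(1), of r "int n"] by simp
    finally show "f (r + (t - s)) = f r" .
  qed
qed (use f energy in auto)

text \<open>Otherwise the function is nonincreasing and periodic, hence constant, and half of
  \<open>T\<close> would be a smaller period.\<close>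

lemma periodic_has_positive_derivative:
  fixes f f' :: "real \<Rightarrow> real"
  assumes d: "\<And>t. (f has_real_derivative f' t) (at t)" and T: "is_minimal_period f T"
  obtains t where "f' t > 0"
proof (rule ccontr)
  assume "\<not> thesis"
  then have neg: "f' t \<le> 0" for t using that not_le by blast
  have per: "has_period f T" and "T > 0" using T by (auto simp: is_minimal_period_def)
  have anti: "f b \<le> f a" if "a \<le> b" for a b
    using that by (rule DERIV_nonpos_imp_nonincreasing) (use d neg in blast)
  have "f b \<ge> f a" if "a \<le> b" for a b
  proof -
    obtain n :: nat where "real n * T > b - a"
      using reals_Archimedean3[OF \<open>T > 0\<close>] by blast
    then have "f (a + of_int (int n) * T) \<le> f b" by (intro anti) simp
    then show ?thesis by (simp only: has_period_of_int[OF per])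
  qed
  with anti have "f a = f b" for a b by (meson linear order_antisym)
  then have "has_period f (T/2)" by (simp add: has_period_def)
  then have "T \<le> T/2"
    using T half_gt_zero[OF \<open>T > 0\<close>] unfolding is_minimal_period_def by blast
  with \<open>T > 0\<close> show False by simp
qed

section \<open>Stability of the minimal period under C^1 perturbation\<close>

lemma increments_of_derivative_bounds:
  fixes g g' :: "real \<Rightarrow> real"
  assumes d: "\<And>t. (g has_real_derivative g' t) (at t)" and "a \<le> b"
    and k: "\<And>t. \<lbrakk>a \<le> t; t \<le> b\<rbrakk> \<Longrightarrow> k \<le> g' t"
  shows "k * (b - a) \<le> g b - g a"
proof (cases "a = b")
  case False
  then obtain z where "a < z" "z < b" "g b - g a = (b - a) * g' z"
    using MVT2[of a b g g'] d \<open>a \<le> b\<close> by auto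
  then show ?thesis using k[of z] \<open>a \<le> b\<close> by (simp add: mult.commute mult_right_mono)
qed simp

text \<open>Upward crossings of the level \<open>c\<close> are followed. Those of \<open>g\<close>
  near \<open>t0\<close> and \<open>t0 + T0\<close> differ by a period of \<open>g\<close>, which
  bounds \<open>T\<close> from above. Conversely, the crossing near \<open>t0\<close> recurs after
  time \<open>T\<close>, and \<open>g\<close> has no upward crossing strictly between the two
  neighbourhoods, which bounds \<open>T\<close> from below.\<close>

lemma minimal_period_C1_stable:
  assumes f: "autonomous_motion f f'" and T0: "is_minimal_period f T0" and "\<delta> > 0"
  obtains \<epsilon> where "\<epsilon> > 0"
    and "\<And>g g' T. \<lbrakk>autonomous_motion g g'; is_minimal_period g T;
          \<And>t. \<bar>g t - f t\<bar> < \<epsilon>; \<And>t. \<bar>g' t - f' t\<bar> < \<epsilon>\<rbrakk> \<Longrightarrow> \<bar>T - T0\<bar> < \<delta>"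
proof -
  have df: "\<And>t. (f has_real_derivative f' t) (at t)" and cf': "continuous_on UNIV f'"
    and ener: "\<And>s t. f s = f t \<Longrightarrow> (f' s)\<^sup>2 = (f' t)\<^sup>2"
    and auto: "\<And>s t. \<lbrakk>f s = f t; f' s = f' t\<rbrakk> \<Longrightarrow> has_period f (t - s)"
    using f unfolding autonomous_motion_def by blast+
  have per: "has_period f T0" and T0pos: "T0 > 0"
    and minT0: "\<And>S. \<lbrakk>S > 0; has_period f S\<rbrakk> \<Longrightarrow> T0 \<le> S"
    using T0 by (auto simp: is_minimal_period_def)
  have per': "has_period f' T0"
    using df by (intro vector_derivative_has_period[OF _ per]) (simp add: has_real_derivative_iff_has_vector_derivative)
  obtain t0 where t0: "f' t0 > 0" by (rule periodic_has_positive_derivative[OF df T0])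
  define m where "m = f' t0"
  define c where "c = f t0"
  have m: "m > 0" using t0 by (simp add: m_def)
  obtain d where d: "d > 0" "\<And>t. \<bar>t - t0\<bar> < d \<Longrightarrow> \<bar>f' t - f' t0\<bar> < m / 2"
    using cf' m by (metis UNIV_I continuous_on_iff dist_real_def half_gt_zero)
  \<comment> \<open>Within \<open>r\<close> of \<open>t0\<close> the slope stays at least
    \<open>m / 2\<close>. The two crossings of \<open>g\<close> are located up to \<open>r\<close>
    each, so the final error is at most \<open>2 * r < \<delta>\<close>;
    \<open>4 * r \<le> T0\<close> keeps the neighbourhoods apart.\<close>
  define r where "r = min (d / 2) (min (\<delta> / 4) (T0 / 4))"
  have r: "0 < r" "r < d" "2 * r < \<delta>" "4 * r \<le> T0"
    using d(1) \<open>\<delta> > 0\<close> T0pos by (auto simp: r_def)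
  have near0: "m / 2 \<le> f' t" if "\<bar>t - t0\<bar> \<le> r" for t
    using d(2)[of t] that r by (simp add: m_def field_simps abs_if split: if_splits)
  have near: "m / 2 \<le> f' t" if "\<bar>t - a\<bar> \<le> r" "a = t0 \<or> a = t0 + T0" for t a
  proof (cases "a = t0")
    case False
    have "f' (t - T0 + T0) = f' (t - T0)" using per' unfolding has_period_def by blast
    then show ?thesis using near0[of "t - T0"] that False by auto
  qed (use near0 that in auto)
  have level: "f a = c" if "a = t0 \<or> a = t0 + T0" for a
    using that per by (auto simp: c_def has_period_def)
  define K where "K = {t0 + r..t0 + T0 - r}"
  \<comment> \<open>Zero exactly where \<open>f\<close> takes the value \<open>c\<close> with
    nonnegative slope. A positive minimum on the compact set \<open>K\<close> therefore excludes
    such crossings in a quantitative way.\<close>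
  define \<phi> where "\<phi> = (\<lambda>t. \<bar>f t - c\<bar> + max 0 (- f' t))"
  have "continuous_on K \<phi>"
    unfolding \<phi>_def using df
    by (intro continuous_intros continuous_on_subset[OF cf'] DERIV_continuous_on)
       (auto intro: DERIV_subset)
  moreover have "compact K" "K \<noteq> {}" using r by (auto simp: K_def)
  ultimately obtain tm where tm: "tm \<in> K" "\<And>t. t \<in> K \<Longrightarrow> \<phi> tm \<le> \<phi> t"
    using continuous_attains_inf[of K \<phi>] by blast
  have "\<phi> tm > 0"
  proof (rule ccontr)
    assume "\<not> \<phi> tm > 0"
    then have "f tm = c" "f' tm \<ge> 0" by (auto simp: \<phi>_def abs_if max_def split: if_splits)
    \<comment> \<open>Equal heights give equal speeds, so a nonnegative slope at \<open>tm\<close>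
      must equal \<open>m\<close>. Then \<open>tm - t0\<close> would be a positive period smaller
      than \<open>T0\<close>.\<close>
    moreover have "(f' tm)\<^sup>2 = m\<^sup>2" using ener[of tm t0] \<open>f tm = c\<close> by (simp add: c_def m_def)
    ultimately have "f' tm = m" using m by (simp add: power2_eq_iff_nonneg)
    then have "has_period f (tm - t0)" using auto[of t0 tm] \<open>f tm = c\<close> by (simp add: c_def m_def)
    then have "T0 \<le> tm - t0" using minT0 tm(1) r by (auto simp: K_def)
    then show False using tm(1) r by (auto simp: K_def)
  qed
  \<comment> \<open>The three bounds keep the slope of \<open>g\<close> at least
    \<open>m / 4\<close> near the crossings, keep \<open>g\<close> on the correct side of
    \<open>c\<close> at distance \<open>r\<close> from them (\<open>f\<close> has moved by
    \<open>m * r / 2\<close> there), and prevent new upward crossings in \<open>K\<close>.\<close>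
  define \<epsilon> where "\<epsilon> = min (m / 4) (min (m * r / 4) (\<phi> tm / 4))"
  have \<epsilon>: "\<epsilon> > 0" "\<epsilon> \<le> m / 4" "\<epsilon> \<le> m * r / 4" "\<epsilon> \<le> \<phi> tm / 4"
    using m r \<open>\<phi> tm > 0\<close> unfolding \<epsilon>_def by auto
  show thesis
  proof (rule that[OF \<epsilon>(1)])
    fix g g' T
    assume g: "autonomous_motion g g'" and T: "is_minimal_period g T"
      and gf: "\<And>t. \<bar>g t - f t\<bar> < \<epsilon>" and gf': "\<And>t. \<bar>g' t - f' t\<bar> < \<epsilon>"
    have dg: "\<And>t. (g has_real_derivative g' t) (at t)"
      and generg: "\<And>s t. g s = g t \<Longrightarrow> (g' s)\<^sup>2 = (g' t)\<^sup>2"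
      and autog: "\<And>s t. \<lbrakk>g s = g t; g' s = g' t\<rbrakk> \<Longrightarrow> has_period g (t - s)"
      using g unfolding autonomous_motion_def by blast+
    have perg: "has_period g T" and Tpos: "T > 0"
      and minT: "\<And>S. \<lbrakk>S > 0; has_period g S\<rbrakk> \<Longrightarrow> T \<le> S"
      using T by (auto simp: is_minimal_period_def)
    have perg': "has_period g' T"
      using dg by (intro vector_derivative_has_period[OF _ perg]) (simp add: has_real_derivative_iff_has_vector_derivative)
    have pos: "m / 4 \<le> g' t" if "\<bar>t - a\<bar> \<le> r" "a = t0 \<or> a = t0 + T0" for t a
      using near[OF that] gf'[of t] \<epsilon>(2) by linarith
    have crossing: "\<exists>s. \<bar>s - a\<bar> \<le> r \<and> g s = c" if a: "a = t0 \<or> a = t0 + T0" for a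
    proof -
      have "m / 2 * ((a + r) - a) \<le> f (a + r) - f a"
        using near[OF _ a] r by (intro increments_of_derivative_bounds[OF df]) auto
      moreover have "m / 2 * (a - (a - r)) \<le> f a - f (a - r)"
        using near[OF _ a] r by (intro increments_of_derivative_bounds[OF df]) auto
      ultimately have "g (a - r) \<le> c" "c \<le> g (a + r)"
        using level[OF a] gf[of "a + r"] gf[of "a - r"] \<epsilon>(3) mult_pos_pos[OF m r(1)]
        by (simp_all add: abs_less_iff)
      moreover have "a - r \<le> a + r" using r by simp
      ultimately obtain s where "a - r \<le> s" "s \<le> a + r" "g s = c"
        using IVT[of g "a - r" c "a + r"] DERIV_isCont[OF dg] by blast
      then show ?thesis by (intro exI[of _ s]) (simp add: abs_le_iff)
    qed
    obtain s1 where s1: "\<bar>s1 - t0\<bar> \<le> r" "g s1 = c" using crossing by blast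
    obtain s2 where s2: "\<bar>s2 - (t0 + T0)\<bar> \<le> r" "g s2 = c" using crossing by blast
    have "g' s1 > 0" "g' s2 > 0" using pos[OF s1(1)] pos[OF s2(1)] m by auto
    \<comment> \<open>Both slopes are positive and have the same square, so the two crossings are
      the same phase point of \<open>g\<close>.\<close>
    then have "g' s1 = g' s2" using generg[of s1 s2] s1 s2 by (simp add: power2_eq_iff_nonneg)
    then have "has_period g (s2 - s1)" using autog s1 s2 by simp
    then have upper: "T \<le> s2 - s1" using s1 s2 r by (intro minT) auto
    have gs: "g (s1 + T) = c" "g' (s1 + T) > 0"
      using perg perg' s1 \<open>g' s1 > 0\<close> by (auto simp: has_period_def)
    \<comment> \<open>\<open>g\<close> is strictly increasing on the neighbourhood of
      \<open>t0\<close>, so it cannot return to \<open>c\<close> there.\<close>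
    have "s1 + T > t0 + r"
    proof (rule ccontr)
      assume "\<not> s1 + T > t0 + r"
      then have "m / 4 * (s1 + T - s1) \<le> g (s1 + T) - g s1"
        using pos[of _ t0] s1 Tpos by (intro increments_of_derivative_bounds[OF dg]) auto
      then have "m * T \<le> 0" using gs s1 by simp
      then show False using mult_pos_pos[OF m Tpos] by simp
    qed
    moreover have "s1 + T \<notin> K"
    proof
      assume "s1 + T \<in> K"
      then have "4 * \<epsilon> \<le> \<phi> (s1 + T)" using tm(2)[of "s1 + T"] \<epsilon>(4) by simp
      \<comment> \<open>At an upward crossing of \<open>g\<close>, each of the two summands of
        \<open>\<phi>\<close> is below \<open>\<epsilon>\<close>.\<close>
      moreover have "\<phi> (s1 + T) < 2 * \<epsilon>"
        using gf[of "s1 + T"] gf'[of "s1 + T"] gs \<epsilon>(1) unfolding \<phi>_def by linarith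
      ultimately show False using \<epsilon>(1) by simp
    qed
    ultimately have "s1 + T > t0 + T0 - r" by (auto simp: K_def)
    then show "\<bar>T - T0\<bar> < \<delta>" using upper s1 s2 r by linarith
  qed
qed

text \<open>The bound is the gap between \<open>a / q0\<close> and \<open>a / (q0 + 1)\<close>, its
  nearest neighbour among the fractions \<open>a / q\<close>.\<close>

lemma fractions_isolated:
  fixes a :: real and q q0 :: nat
  assumes "a > 0" "q > 0" "q0 > 0" "\<bar>a / real q - a / real q0\<bar> < a / (real q0 * (real q0 + 1))"
  shows "q = q0"
proof -
  have "\<bar>a / real q - a / real q0\<bar> = a * \<bar>real q0 - real q\<bar> / (real q * real q0)"
  proof -
    have "a / real q - a / real q0 = a * (real q0 - real q) / (real q * real q0)"
      using assms by (simp add: field_simps)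
    then show ?thesis using assms(1) by (simp add: abs_mult)
  qed
  also have "\<dots> = a / (real q0 * (real q0 + 1)) * (\<bar>real q0 - real q\<bar> * (real q0 + 1) / real q)"
    using assms by simp
  finally have "a / (real q0 * (real q0 + 1)) * (\<bar>real q0 - real q\<bar> * (real q0 + 1) / real q)
      < a / (real q0 * (real q0 + 1)) * 1"
    using assms(4) by simp
  then have "\<bar>real q0 - real q\<bar> * (real q0 + 1) / real q < 1"
    by (rule mult_less_cancel_left_pos[THEN iffD1, rotated]) (use assms in auto)
  then have "\<bar>real q0 - real q\<bar> * (real q0 + 1) < real q"
    using assms by simp
  \<comment> \<open>Over the integers, \<open>q \<noteq> q0\<close> means a difference of at least
    1.\<close>
  then have lt: "\<bar>int q0 - int q\<bar> * (int q0 + 1) < int q"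
    by (metis (mono_tags, opaque_lifting) of_int_1 of_int_abs of_int_add of_int_diff of_int_less_iff of_int_mult of_int_of_nat_eq)
  show ?thesis
  proof (rule ccontr)
    assume "q \<noteq> q0"
    then consider "int q \<ge> int q0 + 1" | "int q \<le> int q0 - 1" by linarith
    then show False
    proof cases
      case 1
      then have "(int q - int q0 - 1) * (int q0 + 1) \<ge> (int q - int q0 - 1) * 1"
        by (intro mult_left_mono) auto
      with 1 lt show False by (simp add: algebra_simps)
    next
      case 2
      then have "1 * (int q0 + 1) \<le> \<bar>int q0 - int q\<bar> * (int q0 + 1)"
        by (intro mult_right_mono) auto
      from order.strict_trans1[OF this lt] 2 show False by simp
    qed
  qed
qed

subsection \<open>The vertical nodal number\<close>

text \<open>Coordinates, with the denominator \<open>R^2\<close> cleared, turn the identities that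
  follow into polynomial ones that \<open>algebra\<close> can decide.\<close>

lemma zero_set_components:
  assumes R: "R > 0" and z: "(\<mu>, u) \<in> zero_set R"
    and x_def: "x = curve R u" and v_def: "v = vderiv (curve R u)"
    and g_def: "g = (\<lambda>t. accel R \<mu> (x t) (v t))"
  shows "((\<lambda>t. x t $ i) has_real_derivative v t $ i) (at t)"
    and "((\<lambda>t. v t $ i) has_real_derivative g t $ i) (at t)"
    and "(x t $ 1)\<^sup>2 + (x t $ 2)\<^sup>2 + (x t $ 3)\<^sup>2 = R\<^sup>2"
    and "x t $ 1 * v t $ 1 + x t $ 2 * v t $ 2 + x t $ 3 * v t $ 3 = 0"
    and "R\<^sup>2 * g t $ 1 = - (v t \<bullet> v t) * x t $ 1 + \<mu> * x t $ 3 * x t $ 1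
           + \<mu> * (x t $ 2 * v t $ 3 - x t $ 3 * v t $ 2)"
    and "R\<^sup>2 * g t $ 2 = - (v t \<bullet> v t) * x t $ 2 + \<mu> * x t $ 3 * x t $ 2
           + \<mu> * (x t $ 3 * v t $ 1 - x t $ 1 * v t $ 3)"
    and "R\<^sup>2 * g t $ 3 = - (v t \<bullet> v t) * x t $ 3 - \<mu> * (R\<^sup>2 - (x t $ 3)\<^sup>2)
           + \<mu> * (x t $ 1 * v t $ 2 - x t $ 2 * v t $ 1)"
proof -
  note D = zero_set_derivs[OF R z x_def v_def]
  show "((\<lambda>t. x t $ i) has_real_derivative v t $ i) (at t)"
       "((\<lambda>t. v t $ i) has_real_derivative g t $ i) (at t)"
    using bounded_linear.has_vector_derivative[OF bounded_linear_vec_nth D(1), of i t]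
      bounded_linear.has_vector_derivative[OF bounded_linear_vec_nth D(2), of i t]
    by (simp_all add: has_real_derivative_iff_has_vector_derivative g_def)
  show "(x t $ 1)\<^sup>2 + (x t $ 2)\<^sup>2 + (x t $ 3)\<^sup>2 = R\<^sup>2"
    and "x t $ 1 * v t $ 1 + x t $ 2 * v t $ 2 + x t $ 3 * v t $ 3 = 0"
    using D(3,4)[of t] by (simp_all add: inner_vec_def sum_3 power2_eq_square)
  have "R\<^sup>2 *\<^sub>R g t = - (v t \<bullet> v t) *\<^sub>R x t - \<mu> *\<^sub>R (R\<^sup>2 *\<^sub>R axis 3 1 - (x t $ 3) *\<^sub>R x t)
      + \<mu> *\<^sub>R cross3 (x t) (v t)"
    using R by (simp add: g_def accel_def)
  then have e: "R\<^sup>2 * g t $ j = (- (v t \<bullet> v t) *\<^sub>R x t - \<mu> *\<^sub>R (R\<^sup>2 *\<^sub>R axis 3 1 - (x t $ 3) *\<^sub>R x t)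
      + \<mu> *\<^sub>R cross3 (x t) (v t)) $ j" for j
    by (metis real_scaleR_def vector_scaleR_component)
  show "R\<^sup>2 * g t $ 1 = - (v t \<bullet> v t) * x t $ 1 + \<mu> * x t $ 3 * x t $ 1
           + \<mu> * (x t $ 2 * v t $ 3 - x t $ 3 * v t $ 2)"
       "R\<^sup>2 * g t $ 2 = - (v t \<bullet> v t) * x t $ 2 + \<mu> * x t $ 3 * x t $ 2
           + \<mu> * (x t $ 3 * v t $ 1 - x t $ 1 * v t $ 3)"
       "R\<^sup>2 * g t $ 3 = - (v t \<bullet> v t) * x t $ 3 - \<mu> * (R\<^sup>2 - (x t $ 3)\<^sup>2)
           + \<mu> * (x t $ 1 * v t $ 2 - x t $ 2 * v t $ 1)"
    unfolding e by (simp_all add: cross_components axis_def power2_eq_square algebra_simps)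
qed

text \<open>In terms of the constants \<open>C\<close> and \<open>E\<close> of the vertical polynomial, the
  second constant is \<open>K = E / \<mu> + C\<close>.\<close>

lemma zero_set_conserved:
  assumes R: "R > 0" and z: "(\<mu>, u) \<in> zero_set R"
    and x_def: "x = curve R u" and v_def: "v = vderiv (curve R u)"
  obtains C K where "\<And>t. x t $ 1 * v t $ 2 - x t $ 2 * v t $ 1 + \<mu> * x t $ 3 = C"
    and "\<And>t. (v t \<bullet> v t) / 2 + \<mu> * x t $ 3 = K"
proof -
  define g where "g = (\<lambda>t. accel R \<mu> (x t) (v t))"
  note S = zero_set_components[OF R z x_def v_def g_def]
  let ?C = "\<lambda>t. x t $ 1 * v t $ 2 - x t $ 2 * v t $ 1 + \<mu> * x t $ 3"
  let ?K = "\<lambda>t. (v t \<bullet> v t) / 2 + \<mu> * x t $ 3"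
  have "(?C has_real_derivative 0) (at t)" for t
  proof -
    \<comment> \<open>The bracket is the derivative of the first quantity. Its vanishing is the
      vertical component of the equation of motion, because e_3 \<times> x is horizontal.\<close>
    have "R\<^sup>2 * (x t $ 1 * g t $ 2 - x t $ 2 * g t $ 1 + \<mu> * v t $ 3) = 0"
      using S(3-6)[of t] by algebra
    then have "x t $ 1 * g t $ 2 - x t $ 2 * g t $ 1 + \<mu> * v t $ 3 = 0" using R by simp
    moreover have "(?C has_real_derivative x t $ 1 * g t $ 2 - x t $ 2 * g t $ 1 + \<mu> * v t $ 3) (at t)"
      by (auto intro!: derivative_eq_intros S(1,2))
    ultimately show ?thesis by simp
  qed
  then have "?C t = ?C 0" for t using DERIV_isconst_all by blast
  moreover have "(?K has_real_derivative 0) (at t)" for t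
  proof -
    \<comment> \<open>The bracket is x' . x'' + \<mu> x_3'. It vanishes because x' is orthogonal to
      both x and x \<times> x', so only the e_3 term of the acceleration contributes.\<close>
    have "R\<^sup>2 * (v t $ 1 * g t $ 1 + v t $ 2 * g t $ 2 + v t $ 3 * g t $ 3 + \<mu> * v t $ 3) = 0"
      using S(4-7)[of t] by algebra
    then have "v t $ 1 * g t $ 1 + v t $ 2 * g t $ 2 + v t $ 3 * g t $ 3 + \<mu> * v t $ 3 = 0" using R by simp
    moreover have "(?K has_real_derivative
        v t $ 1 * g t $ 1 + v t $ 2 * g t $ 2 + v t $ 3 * g t $ 3 + \<mu> * v t $ 3) (at t)"
      unfolding inner_vec_def sum_3 by (auto intro!: derivative_eq_intros S(1,2))
    ultimately show ?thesis by simp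
  qed
  then have "?K t = ?K 0" for t using DERIV_isconst_all by blast
  ultimately show thesis using that by blast
qed

lemma curve_has_period:
  assumes "u \<in> H2"
  shows "has_period (curve R u) (2*pi)"
  using assms by (simp add: H2_def has_period_def curve_def circle_curve_def)

text \<open>The two conserved quantities eliminate the horizontal coordinates: x_3'' becomes a
  quadratic in x_3 and (x_3')^2 a cubic. The cubic is the vertical polynomial rewritten with
  \<open>C\<close> and \<open>K\<close>, and the quadratic is half its derivative.\<close>

lemma height_autonomous_motion:
  assumes R: "R > 0" and z: "(\<mu>, u) \<in> zero_set R"
  shows "autonomous_motion (height R u) (\<lambda>t. vderiv (curve R u) t $ 3)"
proof -
  define x where "x = curve R u"
  define v where "v = vderiv (curve R u)"
  define g where "g = (\<lambda>t. accel R \<mu> (x t) (v t))"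
  note S = zero_set_components[OF R z x_def v_def g_def]
  obtain C K where C: "\<And>t. x t $ 1 * v t $ 2 - x t $ 2 * v t $ 1 + \<mu> * x t $ 3 = C"
    and K: "\<And>t. (v t \<bullet> v t) / 2 + \<mu> * x t $ 3 = K"
    using zero_set_conserved[OF R z x_def v_def] by blast
  have h: "height R u = (\<lambda>t. x t $ 3)" by (simp add: height_def x_def fun_eq_iff)
  have vv: "v t \<bullet> v t = (v t $ 1)\<^sup>2 + (v t $ 2)\<^sup>2 + (v t $ 3)\<^sup>2" for t
    by (simp add: inner_vec_def sum_3 power2_eq_square)
  have "autonomous_motion (\<lambda>t. x t $ 3) (\<lambda>t. v t $ 3)"
  proof (rule autonomous_motionI)
    show "((\<lambda>t. x t $ 3) has_real_derivative v t $ 3) (at t)" for t by (rule S(1))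
    show "((\<lambda>t. v t $ 3) has_real_derivative
        (3 * \<mu> / R\<^sup>2) * (x t $ 3)\<^sup>2 + (- (2 * K + \<mu>\<^sup>2) / R\<^sup>2) * x t $ 3 + (\<mu> * C / R\<^sup>2 - \<mu>)) (at t)" for t
    proof -
      have "R\<^sup>2 * g t $ 3 = 3 * \<mu> * (x t $ 3)\<^sup>2 - (2 * K + \<mu>\<^sup>2) * x t $ 3 + (\<mu> * C - \<mu> * R\<^sup>2)"
      proof -
        have "v t \<bullet> v t = 2 * K - 2 * \<mu> * x t $ 3" using K[of t] by simp
        then show ?thesis using S(7)[of t] C[of t] by algebra
      qed
      then have "g t $ 3 = (3 * \<mu> * (x t $ 3)\<^sup>2 - (2 * K + \<mu>\<^sup>2) * x t $ 3 + (\<mu> * C - \<mu> * R\<^sup>2)) / R\<^sup>2"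
        using R by (simp add: eq_divide_eq mult.commute)
      then have "g t $ 3 = (3 * \<mu> / R\<^sup>2) * (x t $ 3)\<^sup>2 + (- (2 * K + \<mu>\<^sup>2) / R\<^sup>2) * x t $ 3 + (\<mu> * C / R\<^sup>2 - \<mu>)"
        using R by (simp add: add_divide_distrib diff_divide_distrib distrib_right left_diff_distrib)
      then show ?thesis using S(2)[where i = 3 and t = t] by simp
    qed
    show "(v t $ 3)\<^sup>2 = (\<lambda>s. ((R\<^sup>2 - s\<^sup>2) * (2 * K - 2 * \<mu> * s) - (C - \<mu> * s)\<^sup>2) / R\<^sup>2) (x t $ 3)" for t
    proof -
      have "2 * K - 2 * \<mu> * x t $ 3 = (v t $ 1)\<^sup>2 + (v t $ 2)\<^sup>2 + (v t $ 3)\<^sup>2"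
        using K[of t] by (simp add: vv field_simps)
      moreover have "C - \<mu> * x t $ 3 = x t $ 1 * v t $ 2 - x t $ 2 * v t $ 1"
        using C[of t] by simp
      \<comment> \<open>Lagrange's identity in the horizontal plane: with y and w the horizontal
        parts of x and x', |y|^2 |w|^2 = (y . w)^2 + (y_1 w_2 - y_2 w_1)^2, where |y|^2 = R^2 -
        x_3^2 and y . w = - x_3 x_3'.\<close>
      ultimately have "R\<^sup>2 * (v t $ 3)\<^sup>2 =
          (R\<^sup>2 - (x t $ 3)\<^sup>2) * (2 * K - 2 * \<mu> * x t $ 3) - (C - \<mu> * x t $ 3)\<^sup>2"
        using S(3,4)[of t] by algebra
      then show ?thesis using R by (simp add: field_simps)
    qed
    show "\<bar>x t $ 3\<bar> \<le> R" for t
    proof -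
      have "(x t $ 3)\<^sup>2 \<le> R\<^sup>2"
        using S(3)[of t] zero_le_power2[of "x t $ 1"] zero_le_power2[of "x t $ 2"] by linarith
      then show ?thesis using R abs_le_square_iff[of "x t $ 3" R] by simp
    qed
    show "has_period (\<lambda>t. x t $ 3) (2*pi)"
      using curve_has_period[of u R] z by (auto simp: zero_set_def has_period_def x_def)
  qed simp
  then show ?thesis by (simp add: h v_def)
qed

section \<open>From the minimal period to the integer q\<close>

lemma curve_diff: "curve R u t - curve R v t = u t - v t"
  by (simp add: curve_def)

lemma nodal_number_minimal_period:
  assumes "(\<mu>, u) \<in> regular_set R"
  shows "vertical_nodal_number R (\<mu>, u) > 0"
    and "is_minimal_period (height R u) (2*pi / real (vertical_nodal_number R (\<mu>, u)))"
proof -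
  have u: "u \<in> H2" and nc: "\<not> height R u constant_on UNIV"
    using assms by (auto simp: regular_set_def zero_set_def)
  have "continuous_on UNIV (curve R u)"
    using curve_has_vector_derivative[OF u]
    by (meson continuous_at_imp_continuous_on has_vector_derivative_continuous)
  then have "continuous_on UNIV (height R u)"
    unfolding height_def[abs_def] by (intro continuous_intros)
  moreover have "has_period (height R u) (2*pi)"
    using curve_has_period[OF u] by (simp add: has_period_def height_def)
  ultimately have "\<exists>!q. q > 0 \<and> is_minimal_period (height R u) (2*pi / real q)"
    using nc by (rule nodal_number_ex1)
  from theI'[OF this] show "vertical_nodal_number R (\<mu>, u) > 0"
      "is_minimal_period (height R u) (2*pi / real (vertical_nodal_number R (\<mu>, u)))"
    by (simp_all add: vertical_nodal_number_def)
qed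

lemma nodal_number_H2_stable:
  assumes R: "R > 0" and z: "(\<mu>, u) \<in> regular_set R"
  obtains \<epsilon> where "\<epsilon> > 0"
    and "\<And>\<mu>' u'. \<lbrakk>(\<mu>', u') \<in> regular_set R; H2_dist u u' < \<epsilon>\<rbrakk>
          \<Longrightarrow> vertical_nodal_number R (\<mu>', u') = vertical_nodal_number R (\<mu>, u)"
proof -
  let ?q = "vertical_nodal_number R"
  have zz: "(\<mu>, u) \<in> zero_set R" and u: "u \<in> H2"
    using z by (auto simp: regular_set_def zero_set_def)
  \<comment> \<open>The distance from the period 2 pi / q to the nearest other value 2 pi / q' with
    q' a positive integer; periods closer than this have the same nodal number.\<close>
  define \<delta> where "\<delta> = 2*pi / (real (?q (\<mu>, u)) * (real (?q (\<mu>, u)) + 1))"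
  note q0 = nodal_number_minimal_period[OF z]
  have "\<delta> > 0" using q0(1) by (simp add: \<delta>_def)
  then obtain e where e: "e > 0"
    "\<And>g g' T. \<lbrakk>autonomous_motion g g'; is_minimal_period g T;
          \<And>t. \<bar>g t - height R u t\<bar> < e; \<And>t. \<bar>g' t - vderiv (curve R u) t $ 3\<bar> < e\<rbrakk>
        \<Longrightarrow> \<bar>T - 2*pi / real (?q (\<mu>, u))\<bar> < \<delta>"
    using minimal_period_C1_stable[OF height_autonomous_motion[OF R zz] q0(2)] by blast
  show thesis
  \<comment> \<open>Dividing by 6 compensates the Sobolev constant.\<close>
  proof (rule that[of "e / 6"])
    show "e / 6 > 0" using e(1) by simp
    fix \<mu>' u'
    assume z': "(\<mu>', u') \<in> regular_set R" and d: "H2_dist u u' < e / 6"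
    have zz': "(\<mu>', u') \<in> zero_set R" and u': "u' \<in> H2"
      using z' by (auto simp: regular_set_def zero_set_def)
    note close = H2_dist_imp_C1_close[OF u u' \<open>e / 6 > 0\<close> d]
    have comp: "\<bar>(y :: real^3) $ 3 - w $ 3\<bar> \<le> norm (w - y)" for y w
      using component_le_norm_cart[of "w - y" 3] by (simp add: abs_minus_commute)
    have "\<bar>height R u' t - height R u t\<bar> < e" for t
      using close(1)[of t] comp[of "curve R u' t" "curve R u t"]
      by (simp add: height_def curve_diff)
    moreover have "\<bar>vderiv (curve R u') t $ 3 - vderiv (curve R u) t $ 3\<bar> < e" for t
      using close(2)[of t] comp[of "vderiv (curve R u') t" "vderiv (curve R u) t"]
      by (simp add: fun_cong[OF vderiv_curve[OF u]] fun_cong[OF vderiv_curve[OF u']])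
    ultimately have "\<bar>2*pi / real (?q (\<mu>', u')) - 2*pi / real (?q (\<mu>, u))\<bar> < \<delta>"
      using e(2)[OF height_autonomous_motion[OF R zz'] nodal_number_minimal_period(2)[OF z']] by blast
    then show "?q (\<mu>', u') = ?q (\<mu>, u)"
      using nodal_number_minimal_period(1)[OF z'] q0(1) unfolding \<delta>_def
      by (intro fractions_isolated[of "2*pi"]) auto
  qed
qed

subsection \<open>The horizontal degree\<close>

text \<open>The horizontal projection as a loop in the complex plane, rescaled to the unit interval
  on which paths are parametrized.\<close>

definition horizontal_loop :: "real \<Rightarrow> (real \<Rightarrow> real^3) \<Rightarrow> real \<Rightarrow> complex" where
  "horizontal_loop R u s = Complex (curve R u (2*pi * s) $ 1) (curve R u (2*pi * s) $ 2)"

lemma horizontal_loop_has_vector_derivative: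
  fixes R :: real
  assumes u: "u \<in> H2"
  defines "v \<equiv> vderiv (curve R u)"
  shows "(horizontal_loop R u has_vector_derivative
           of_real (2*pi) * Complex (v (2*pi * s) $ 1) (v (2*pi * s) $ 2)) (at s)"
proof -
  let ?x = "curve R u"
  have dx: "(?x has_vector_derivative v t) (at t)" for t
    using curve_has_vector_derivative[OF u] by (simp add: v_def fun_cong[OF vderiv_curve[OF u]])
  have "((?x \<circ> (\<lambda>s. 2*pi * s)) has_vector_derivative (2*pi) *\<^sub>R v (2*pi * s)) (at s)"
    by (rule vector_diff_chain_at[OF _ dx]) (auto intro!: derivative_eq_intros)
  then have "((\<lambda>s. ?x (2*pi * s) $ i) has_vector_derivative ((2*pi) *\<^sub>R v (2*pi * s)) $ i) (at s)" for i
    using bounded_linear.has_vector_derivative[OF bounded_linear_vec_nth] by (fastforce simp: o_def)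
  then show ?thesis
    unfolding has_vector_derivative_complex_iff horizontal_loop_def
    by (simp add: has_real_derivative_iff_has_vector_derivative)
qed

lemma valid_path_horizontal_loop:
  assumes "u \<in> H2"
  shows "valid_path (horizontal_loop R u)"
    and "pathfinish (horizontal_loop R u) = pathstart (horizontal_loop R u)"
proof -
  let ?v = "vderiv (curve R u)"
  have c: "continuous_on {0..1} (\<lambda>s. ?v (2*pi * s))"
    by (rule continuous_on_compose2[OF abs_cont_deriv_continuous_on[OF abs_cont_deriv_curve[OF assms], of UNIV]])
      (auto intro!: continuous_intros)
  have "continuous_on {0..1} (\<lambda>s. of_real (2*pi) * Complex (?v (2*pi * s) $ 1) (?v (2*pi * s) $ 2))"
    unfolding Complex_eq by (intro continuous_intros c)
  with horizontal_loop_has_vector_derivative[OF assms, of R]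
  have "horizontal_loop R u C1_differentiable_on {0..1}"
    unfolding C1_differentiable_on_def
    by (intro exI[of _ "\<lambda>s. of_real (2*pi) * Complex (?v (2*pi * s) $ 1) (?v (2*pi * s) $ 2)"]) blast
  then show "valid_path (horizontal_loop R u)"
    unfolding valid_path_def by (rule C1_differentiable_imp_piecewise)
  have "curve R u (0 + 2*pi) = curve R u 0"
    using curve_has_period[OF assms] unfolding has_period_def by blast
  then show "pathfinish (horizontal_loop R u) = pathstart (horizontal_loop R u)"
    by (simp add: pathfinish_def pathstart_def horizontal_loop_def)
qed

text \<open>The imaginary part of \<gamma>'/\<gamma> is the integrand of the degree, up to the
  factor 2 pi from rescaling. The contour integral of 1/w is 2 pi i times the winding number, so its
  imaginary part gives the real part of the winding number.\<close>

lemma horizontal_degree_eq_winding_number: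
  assumes u: "u \<in> H2" and nz: "\<And>t. (curve R u t $ 1)\<^sup>2 + (curve R u t $ 2)\<^sup>2 \<noteq> 0"
  shows "horizontal_degree R (\<mu>, u) = Re (winding_number (horizontal_loop R u) 0)"
proof -
  let ?x = "curve R u" and ?v = "vderiv (curve R u)" and ?\<gamma> = "horizontal_loop R u"
  define h where "h = (\<lambda>t. (?x t $ 1 * ?v t $ 2 - ?x t $ 2 * ?v t $ 1) / ((?x t $ 1)\<^sup>2 + (?x t $ 2)\<^sup>2))"
  let ?F = "\<lambda>s. 1 / (?\<gamma> s - 0) * vector_derivative ?\<gamma> (at s)"
  have 0: "0 \<notin> path_image ?\<gamma>"
    using nz by (auto simp: path_image_def horizontal_loop_def complex_eq_iff)
  note vp = valid_path_horizontal_loop(1)[OF u, of R]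
  have int: "?F integrable_on {0..1}"
    using contour_integrable_inversediff[OF vp 0] by (simp add: contour_integrable_on)
  have "contour_integral ?\<gamma> (\<lambda>w. 1 / (w - 0)) = 2 * pi * \<i> * winding_number ?\<gamma> 0"
    by (simp add: winding_number_valid_path[OF vp 0])
  then have "integral {0..1} ?F = 2 * pi * \<i> * winding_number ?\<gamma> 0"
    by (simp add: contour_integral_integral)
  then have "2 * pi * Re (winding_number ?\<gamma> 0) = Im (integral {0..1} ?F)" by simp
  also have "\<dots> = integral {0..1} (\<lambda>s. Im (?F s))"
    using integral_linear[OF int bounded_linear_Im] by (simp add: o_def)
  also have "\<dots> = integral {0..1} (\<lambda>s. (2*pi) * h (2*pi * s))"
  proof (rule integral_cong)
    fix s
    show "Im (?F s) = (2*pi) * h (2*pi * s)"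
      unfolding vector_derivative_at[OF horizontal_loop_has_vector_derivative[OF u]]
      by (simp add: horizontal_loop_def h_def Im_divide power2_eq_square) (simp add: algebra_simps add_divide_distrib diff_divide_distrib)
  qed
  also have "\<dots> = 2*pi * integral {0..1} (\<lambda>s. h (2*pi * s))" by simp
  also have "integral {0..1} (\<lambda>s. h (2*pi * s)) = 1 / (2*pi) * integral {0..2*pi} h"
  proof -
    have "(\<lambda>x. x / (2*pi)) ` {0..2*pi} = {0..1::real}"
      by (subst image_divide_atLeastAtMost) auto
    then show ?thesis using integral_stretch_real[of "2*pi" 0 "2*pi" h] by simp
  qed
  finally have "2 * pi * Re (winding_number ?\<gamma> 0) = 2 * pi * (1 / (2*pi) * integral {0..2*pi} h)" .
  then have "Re (winding_number ?\<gamma> 0) = 1 / (2*pi) * integral {0..2*pi} h" by (simp add: field_simps)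
  then show ?thesis by (simp add: horizontal_degree_def h_def Let_def)
qed

text \<open>On the vertical axis the sphere condition would force x_3 to be R or -R.\<close>

lemma regular_set_off_axis:
  assumes "(\<mu>, u) \<in> regular_set R"
  shows "(curve R u t $ 1)\<^sup>2 + (curve R u t $ 2)\<^sup>2 \<noteq> 0"
proof
  assume 0: "(curve R u t $ 1)\<^sup>2 + (curve R u t $ 2)\<^sup>2 = 0"
  have h: "- R < curve R u t $ 3" "curve R u t $ 3 < R" and n: "norm (curve R u t) = R"
    using assms by (auto simp: regular_set_def zero_set_def height_def)
  have "curve R u t \<bullet> curve R u t = R\<^sup>2" using n by (simp add: dot_square_norm)
  then have "(curve R u t $ 3)\<^sup>2 = R\<^sup>2" using 0 by (simp add: inner_vec_def sum_3 power2_eq_square)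
  then show False using h by (auto simp: power2_eq_iff)
qed

text \<open>A loop that stays closer to the given one than the latter's distance from 0 winds
  equally often around 0. That distance is attained at some \<open>s0\<close> by compactness, and is
  positive off the axis.\<close>

lemma horizontal_degree_H2_stable:
  assumes z: "(\<mu>, u) \<in> regular_set R"
  obtains \<epsilon> where "\<epsilon> > 0"
    and "\<And>\<mu>' u'. \<lbrakk>(\<mu>', u') \<in> regular_set R; H2_dist u u' < \<epsilon>\<rbrakk>
          \<Longrightarrow> horizontal_degree R (\<mu>', u') = horizontal_degree R (\<mu>, u)"
proof -
  let ?\<gamma> = "horizontal_loop R"
  have u: "u \<in> H2" using z by (auto simp: regular_set_def zero_set_def)
  note path = valid_path_imp_path[OF valid_path_horizontal_loop(1)]
  have "continuous_on {0..1} (\<lambda>s. norm (?\<gamma> u s))"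
    using path[OF u, of R] unfolding path_def by (intro continuous_intros)
  then obtain s0 where s0: "\<And>s. s \<in> {0..1} \<Longrightarrow> norm (?\<gamma> u s0) \<le> norm (?\<gamma> u s)"
    using continuous_attains_inf[OF compact_Icc, of 0 "1::real" "\<lambda>s. norm (?\<gamma> u s)"]
    by (metis atLeastAtMost_iff empty_iff order_refl zero_le_one)
  have m: "norm (?\<gamma> u s0) > 0"
    using regular_set_off_axis[OF z, of "2*pi * s0"] by (auto simp: horizontal_loop_def complex_eq_iff)
  show thesis
  proof (rule that[of "norm (?\<gamma> u s0) / 6"])
    show e: "norm (?\<gamma> u s0) / 6 > 0" using m by simp
    fix \<mu>' u'
    assume z': "(\<mu>', u') \<in> regular_set R" and d: "H2_dist u u' < norm (?\<gamma> u s0) / 6"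
    have u': "u' \<in> H2" using z' by (auto simp: regular_set_def zero_set_def)
    have "norm (?\<gamma> u' s - ?\<gamma> u s) < norm (?\<gamma> u s - 0)" if "s \<in> {0..1}" for s
    proof -
      define w where "w = curve R u' (2*pi * s) - curve R u (2*pi * s)"
      have "norm (?\<gamma> u' s - ?\<gamma> u s) = sqrt ((w $ 1)\<^sup>2 + (w $ 2)\<^sup>2)"
        by (simp add: horizontal_loop_def cmod_def w_def)
      also have "\<dots> \<le> sqrt (w \<bullet> w)"
        by (simp add: inner_vec_def sum_3 power2_eq_square)
      also have "\<dots> = norm w" by (simp add: norm_eq_sqrt_inner)
      also have "\<dots> < norm (?\<gamma> u s0)"
        using H2_dist_imp_C1_close(1)[OF u u' e d, of "2*pi * s"]
        by (simp add: w_def curve_diff norm_minus_commute)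
      also have "\<dots> \<le> norm (?\<gamma> u s - 0)" using s0[OF that] by simp
      finally show ?thesis .
    qed
    then have "winding_number (?\<gamma> u') 0 = winding_number (?\<gamma> u) 0"
      by (intro winding_number_nearby_loops_eq path u u' valid_path_horizontal_loop(2))
    then show "horizontal_degree R (\<mu>', u') = horizontal_degree R (\<mu>, u)"
      by (simp add: horizontal_degree_eq_winding_number[OF u regular_set_off_axis[OF z]]
          horizontal_degree_eq_winding_number[OF u' regular_set_off_axis[OF z']])
  qed
qed

subsection \<open>Locally constant functions\<close>

text \<open>A level set and its complement are both open, so a connected set that meets the level
  set misses the complement.\<close>

lemma locally_constant_on_imp_constant_on_connectedin:
  assumes f: "locally_constant_on X f" and K: "connectedin X K"
  shows "f constant_on K"
proof (cases "K = {}")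
  case False
  then obtain z where z: "z \<in> K" by blast
  define A where "A = {y \<in> topspace X. f y = f z}"
  define B where "B = {y \<in> topspace X. f y \<noteq> f z}"
  have nbhd: "\<exists>U. openin X U \<and> y \<in> U \<and> (\<forall>y'\<in>U. f y' = f y)" if "y \<in> topspace X" for y
    using f that unfolding locally_constant_on_def constant_on_def by metis
  have op: "openin X {y \<in> topspace X. P (f y)}" for P
  proof (subst openin_subopen, intro ballI)
    fix y assume y: "y \<in> {y \<in> topspace X. P (f y)}"
    then obtain U where U: "openin X U" "y \<in> U" "\<forall>y'\<in>U. f y' = f y" using nbhd[of y] by blast
    then have "U \<subseteq> {y \<in> topspace X. P (f y)}"
      using y openin_subset[OF U(1)] by (metis (mono_tags, lifting) mem_Collect_eq subset_iff)
    with U show "\<exists>T. openin X T \<and> y \<in> T \<and> T \<subseteq> {y \<in> topspace X. P (f y)}" by blast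
  qed
  have "openin X A" "openin X B" unfolding A_def B_def by (rule op)+
  moreover have "K \<subseteq> A \<union> B" "A \<inter> B \<inter> K = {}" "A \<inter> K \<noteq> {}"
    using connectedin_subset_topspace[OF K] z by (auto simp: A_def B_def)
  ultimately have "B \<inter> K = {}" using K unfolding connectedin by blast
  then have "f y = f z" if "y \<in> K" for y
    using that connectedin_subset_topspace[OF K] by (auto simp: B_def)
  then show ?thesis by (auto simp: constant_on_def)
qed (auto simp: constant_on_def)

lemma locally_constant_on_regular_topology:
  assumes stable: "\<And>\<mu> u. (\<mu>, u) \<in> regular_set R \<Longrightarrow>
      \<exists>\<epsilon>>0. \<forall>\<mu>' u'. (\<mu>', u') \<in> regular_set R \<and> H2_dist u u' < \<epsilon> \<longrightarrow> f (\<mu>', u') = f (\<mu>, u)"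
  shows "locally_constant_on (regular_topology R) f"
  unfolding locally_constant_on_def
proof
  interpret Metric_space H2 H2_dist by (rule Metric_space_H2)
  fix z assume "z \<in> topspace (regular_topology R)"
  then have zr: "z \<in> regular_set R" by (simp add: regular_topology_def)
  obtain \<mu> u where z: "z = (\<mu>, u)" by (cases z)
  obtain \<epsilon> where \<epsilon>: "\<epsilon> > 0"
    "\<And>\<mu>' u'. \<lbrakk>(\<mu>', u') \<in> regular_set R; H2_dist u u' < \<epsilon>\<rbrakk> \<Longrightarrow> f (\<mu>', u') = f (\<mu>, u)"
    using stable zr z by blast
  have sub: "regular_set R \<subseteq> zero_set R" by (auto simp: regular_set_def)
  have u: "u \<in> H2" "\<mu> > 0" using zr by (auto simp: z regular_set_def zero_set_def)
  \<comment> \<open>The stability bound \<epsilon> concerns the H^2 distance alone, so the first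
    factor is the whole half-line of parameters.\<close>
  let ?V = "{0<..} \<times> mball u \<epsilon>"
  have "openin ambient_topology ?V"
    unfolding ambient_topology_def by (simp add: openin_prod_Times_iff)
  then have "openin (regular_topology R) (?V \<inter> zero_set R \<inter> regular_set R)"
    unfolding regular_topology_def zero_topology_def by (intro openin_subtopology_Int)
  moreover have "z \<in> ?V \<inter> zero_set R \<inter> regular_set R"
    using zr sub u \<epsilon>(1) by (auto simp: z)
  moreover have "f constant_on (?V \<inter> zero_set R \<inter> regular_set R)"
    unfolding constant_on_def using \<epsilon>(2) by (intro exI[of _ "f z"]) (auto simp: z)
  ultimately show "\<exists>U. openin (regular_topology R) U \<and> z \<in> U \<and> f constant_on U" by blast
qed

theorem lemma4p2:
  fixes R :: real
  assumes "R > 0"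
  shows "locally_constant_on (regular_topology R) (horizontal_degree R) \<and>
         locally_constant_on (regular_topology R) (vertical_nodal_number R) \<and>
         (\<forall>K \<in> connected_components_of (regular_topology R).
            horizontal_degree R constant_on K \<and> vertical_nodal_number R constant_on K)"
proof -
  have p: "locally_constant_on (regular_topology R) (horizontal_degree R)"
    by (rule locally_constant_on_regular_topology) (metis horizontal_degree_H2_stable)
  have q: "locally_constant_on (regular_topology R) (vertical_nodal_number R)"
    by (rule locally_constant_on_regular_topology) (metis nodal_number_H2_stable[OF assms])
  show ?thesis
    using p q by (auto intro: locally_constant_on_imp_constant_on_connectedin
        dest: connectedin_connected_components_of)
qed

end
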